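(* Let $\kappa$ be a critical cardinal and let $\mathcal S\in V_\kappa$ be a symmetric system. Then $\mathcal S$ is $j$-decomposable for every elementary embedding $j\colon V\to M$ (with $M$ a transitive class) such that $\mathrm{crit}(j)=\kappa$.
   Context: A cardinal $\kappa$ is critical if it is the critical point of an elementary embedding $j\colon V_{\kappa+1}\to M$ with $M$ a transitive set. A symmetric system $\langle\mathbb P,\mathscr G,\mathscr F\rangle$: forcing $\mathbb P$, group $\mathscr G$ of automorphisms of $\mathbb P$, normal filter $\mathscr F$ of subgroups of $\mathscr G$ (closed under finite intersections, supergroups, conjugation). Automorphisms act on names recursively by $\sigma\dot x=\{\langle\sigma p,\sigma\dot y\rangle\mid\langle p,\dot y\rangle\in\dot x\}$; $\mathrm{sym}(\dot x)=\{\sigma\in\mathscr G\mid\sigma\dot x=\dot x\}$; $\mathsf{HS}$ is the class of hereditarily symmetric names. A filter is symmetrically $M$-generic if it meets every symmetrically dense open set in $M$ (a set $D$ is symmetrically dense if it is invariant under all elements of some group in the filter). The generic semi-direct product $\mathscr G*\dot{\mathscr H}$ (for $\dot{\mathbb Q},\dot{\mathscr H}\in\mathsf{HS}$ with symmetry group $\mathscr G$ and $\Vdash\dot{\mathscr H}\le\mathrm{Aut}(\dot{\mathbb Q})$) consists of pairs $\langle\sigma,\dot\rho\rangle$, $\sigma\in\mathscr G$, $\Vdash\dot\rho\in\dot{\mathscr H}$, acting on $\mathbb P*\dot{\mathbb Q}$ by $\langle\sigma,\dot\rho\rangle(p,\dot q)=\langle\sigma p,\sigma(\dot\rho\dot q)\rangle$.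 $\mathcal S$ is $j$-decomposable if: (1) there are $m\in j(\mathbb P)$, $\dot{\mathbb Q}\in\mathsf{HS}$ with an isomorphism $\pi\colon j(\mathbb P)\restriction m\cong\mathbb P*\dot{\mathbb Q}$ extending $j(p)\mapsto\langle p,1_{\mathbb Q}\rangle$, $\mathrm{sym}(\dot{\mathbb Q})=\mathscr G$, and $\dot H\in\mathsf{HS}$ with $\Vdash_{\mathbb P}$ "$\dot H$ is symmetrically $\check M$-generic for $\dot{\mathbb Q}$"; (2) there is $\dot{\mathscr H}\in\mathsf{HS}$, $\Vdash\dot{\mathscr H}\le\mathrm{Aut}(\dot{\mathbb Q})$, $\mathrm{sym}(\dot{\mathscr H})=\mathscr G$, and an embedding $\tau\colon\mathscr G\to\mathscr G*\dot{\mathscr H}$ where $\tau(\sigma)$ is $j(\sigma)$ transported through $\pi$, $\tau(\sigma)=\langle\sigma,\dot\rho\rangle$ with $\Vdash\dot\rho``\dot H=\dot H$; (3) $j``\mathscr F$ is a basis for $j(\mathscr F)$. *)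

theory Defs
  imports Main
begin

section \<open>First-order set theory with an additional embedding\<close>

text \<open>
  The universe \<open>V\<close> is a type \<open>'v\<close> with a binary relation \<open>mem\<close> satisfying the first-order axioms
  of ZF; it need not be well-founded externally, and the axiom of choice is not assumed inside it.
  The classes \<open>j\<close> and \<open>M\<close> are a function and a set of the metatheory, and separation and
  replacement hold for formulas that may mention both.  For \<open>j\<close> and \<open>M\<close> definable
  (with parameters) over \<open>V\<close> this is no more than ZF.
  Formulas have named variables and are evaluated over a class \<open>D\<close>.
\<close>

datatype fm =
    Memb nat nat
  | Equal nat nat
  | Emb nat nat
  | Tgt nat
  | Neg fm
  | Conj fm fm
  | Univ nat fm

primrec sat ::
  "('v \<Rightarrow> 'v \<Rightarrow> bool) \<Rightarrow> ('v \<Rightarrow> 'v) \<Rightarrow> 'v set \<Rightarrow> 'v set \<Rightarrow> fm \<Rightarrow> (nat \<Rightarrow> 'v) \<Rightarrow> bool"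
where
  "sat mem j M D (Memb a b) s \<longleftrightarrow> mem (s a) (s b)"
| "sat mem j M D (Equal a b) s \<longleftrightarrow> s a = s b"
| "sat mem j M D (Emb a b) s \<longleftrightarrow> j (s a) = s b"
| "sat mem j M D (Tgt a) s \<longleftrightarrow> s a \<in> M"
| "sat mem j M D (Neg \<phi>) s \<longleftrightarrow> \<not> sat mem j M D \<phi> s"
| "sat mem j M D (Conj \<phi> \<psi>) s \<longleftrightarrow> sat mem j M D \<phi> s \<and> sat mem j M D \<psi> s"
| "sat mem j M D (Univ a \<phi>) s \<longleftrightarrow> (\<forall>x\<in>D. sat mem j M D \<phi> (s(a := x)))"

primrec pure :: "fm \<Rightarrow> bool" where
  "pure (Memb a b) \<longleftrightarrow> True"
| "pure (Equal a b) \<longleftrightarrow> True"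
| "pure (Emb a b) \<longleftrightarrow> False"
| "pure (Tgt a) \<longleftrightarrow> False"
| "pure (Neg \<phi>) \<longleftrightarrow> pure \<phi>"
| "pure (Conj \<phi> \<psi>) \<longleftrightarrow> pure \<phi> \<and> pure \<psi>"
| "pure (Univ a \<phi>) \<longleftrightarrow> pure \<phi>"

text \<open>
  The locales below carry no assumptions; they only fix the parameters of the definitions.
\<close>

locale set_structure =
  fixes mem :: "'v \<Rightarrow> 'v \<Rightarrow> bool"
begin

definition elts :: "'v \<Rightarrow> 'v set" where
  "elts a = {x. mem x a}"

definition models_ZF :: "('v \<Rightarrow> 'v) \<Rightarrow> 'v set \<Rightarrow> bool" where
  "models_ZF j M \<longleftrightarrow>
     (\<forall>x y. elts x = elts y \<longrightarrow> x = y) \<and>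
     (\<forall>x. elts x \<noteq> {} \<longrightarrow> (\<exists>y\<in>elts x. elts y \<inter> elts x = {})) \<and>
     (\<forall>x y. \<exists>z. elts z = {x, y}) \<and>
     (\<forall>x. \<exists>u. elts u = (\<Union>y\<in>elts x. elts y)) \<and>
     (\<forall>x. \<exists>p. elts p = {y. elts y \<subseteq> elts x}) \<and>
     (\<exists>w. (\<exists>e\<in>elts w. elts e = {}) \<and>
          (\<forall>x\<in>elts w. \<exists>y\<in>elts w. elts y = insert x (elts x))) \<and>
     (\<forall>\<phi> s x. \<exists>y. elts y = {a \<in> elts x. sat mem j M UNIV \<phi> (s(0 := a))}) \<and>
     (\<forall>\<phi> s x. (\<forall>a\<in>elts x. \<exists>!b. sat mem j M UNIV \<phi> (s(0 := a, 1 := b))) \<longrightarrow>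
        (\<exists>y. elts y = {b. \<exists>a\<in>elts x. sat mem j M UNIV \<phi> (s(0 := a, 1 := b))}))"

definition elementary_embedding :: "('v \<Rightarrow> 'v) \<Rightarrow> 'v set \<Rightarrow> bool" where
  "elementary_embedding j M \<longleftrightarrow>
     (\<forall>x\<in>M. elts x \<subseteq> M) \<and> range j \<subseteq> M \<and>
     (\<forall>\<phi> s. pure \<phi> \<longrightarrow> (sat mem j M UNIV \<phi> s \<longleftrightarrow> sat mem j M M \<phi> (j \<circ> s)))"


subsection \<open>Sets, functions, ordinals\<close>

definition vset :: "'v set \<Rightarrow> 'v" where
  "vset A = (THE z. elts z = A)"

definition opair :: "'v \<Rightarrow> 'v \<Rightarrow> 'v" where
  "opair a b = vset {vset {a}, vset {a, b}}"

definition ofst :: "'v \<Rightarrow> 'v" where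
  "ofst z = (THE x. \<exists>y. z = opair x y)"

definition osnd :: "'v \<Rightarrow> 'v" where
  "osnd z = (THE y. \<exists>x. z = opair x y)"

definition is_fun :: "'v \<Rightarrow> 'v \<Rightarrow> bool" where
  "is_fun f a \<longleftrightarrow>
     (\<forall>z\<in>elts f. \<exists>x\<in>elts a. \<exists>y. z = opair x y) \<and>
     (\<forall>x\<in>elts a. \<exists>!y. opair x y \<in> elts f)"

definition app :: "'v \<Rightarrow> 'v \<Rightarrow> 'v" where
  "app f x = (THE y. opair x y \<in> elts f)"

definition bij_fun :: "'v \<Rightarrow> 'v \<Rightarrow> 'v \<Rightarrow> bool" where
  "bij_fun f a b \<longleftrightarrow> is_fun f a \<and> bij_betw (app f) (elts a) (elts b)"

definition id_fun :: "'v \<Rightarrow> 'v" where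
  "id_fun a = vset {opair x x |x. x \<in> elts a}"

definition comp_fun :: "'v \<Rightarrow> 'v \<Rightarrow> 'v" where
  "comp_fun f g = vset {opair x z |x z. \<exists>y. opair x y \<in> elts g \<and> opair y z \<in> elts f}"

definition inv_fun :: "'v \<Rightarrow> 'v" where
  "inv_fun f = vset {opair y x |x y. opair x y \<in> elts f}"

definition transitive :: "'v \<Rightarrow> bool" where
  "transitive a \<longleftrightarrow> (\<forall>x\<in>elts a. elts x \<subseteq> elts a)"

definition ordinal :: "'v \<Rightarrow> bool" where
  "ordinal a \<longleftrightarrow> transitive a \<and> (\<forall>x\<in>elts a. transitive x)"

definition cardinal :: "'v \<Rightarrow> bool" where
  "cardinal k \<longleftrightarrow> ordinal k \<and> (\<forall>a\<in>elts k. \<nexists>f. bij_fun f a k)"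

definition zero :: "'v" where
  "zero = vset {}"

definition succ :: "'v \<Rightarrow> 'v" where
  "succ a = vset (insert a (elts a))"

definition omega :: "'v" where
  "omega = vset {n. \<forall>I. zero \<in> elts I \<and> (\<forall>x\<in>elts I. succ x \<in> elts I) \<longrightarrow> n \<in> elts I}"

text \<open>The level \<open>V\<^sub>\<alpha>\<close>, from the recursion \<open>V\<^sub>\<beta> = \<Union>\<^sub>\<gamma>\<^sub><\<^sub>\<beta> Pow V\<^sub>\<gamma>\<close>.\<close>

definition cumul :: "'v \<Rightarrow> 'v" where
  "cumul \<alpha> = (THE v. \<exists>f. is_fun f (succ \<alpha>) \<and>
     (\<forall>\<beta>\<in>elts (succ \<alpha>). elts (app f \<beta>) = {x. \<exists>\<gamma>\<in>elts \<beta>. elts x \<subseteq> elts (app f \<gamma>)}) \<and>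
     v = app f \<alpha>)"


subsection \<open>Critical cardinals\<close>

text \<open>
  An embedding of \<open>V\<^sub>\<kappa>\<^sub>+\<^sub>1\<close> is a set, so its elementarity refers to the formulas and the satisfaction
  relation of \<open>V\<close>.  Formulas are coded with the tags \<open>0\<close> (membership), \<open>1\<close> (equality),
  \<open>2\<close> (negated conjunction), \<open>3\<close> (universal quantifier).
\<close>

definition code_mem :: "'v \<Rightarrow> 'v \<Rightarrow> 'v" where
  "code_mem a b = opair zero (opair a b)"

definition code_eq :: "'v \<Rightarrow> 'v \<Rightarrow> 'v" where
  "code_eq a b = opair (succ zero) (opair a b)"

definition code_nand :: "'v \<Rightarrow> 'v \<Rightarrow> 'v" where
  "code_nand f g = opair (succ (succ zero)) (opair f g)"

definition code_all :: "'v \<Rightarrow> 'v \<Rightarrow> 'v" where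
  "code_all a f = opair (succ (succ (succ zero))) (opair a f)"

definition codes :: "'v set" where
  "codes = \<Inter> {elts F |F.
     (\<forall>a\<in>elts omega. \<forall>b\<in>elts omega. code_mem a b \<in> elts F \<and> code_eq a b \<in> elts F) \<and>
     (\<forall>f\<in>elts F. \<forall>g\<in>elts F. code_nand f g \<in> elts F) \<and>
     (\<forall>a\<in>elts omega. \<forall>f\<in>elts F. code_all a f \<in> elts F)}"

definition assignments :: "'v \<Rightarrow> 'v set" where
  "assignments A = {s. is_fun s omega \<and> (\<forall>n\<in>elts omega. app s n \<in> elts A)}"

definition update :: "'v \<Rightarrow> 'v \<Rightarrow> 'v \<Rightarrow> 'v" where
  "update s n x = vset {opair i (if i = n then x else app s i) |i. i \<in> elts omega}"

definition satisfaction_relation :: "'v \<Rightarrow> 'v \<Rightarrow> bool" where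
  "satisfaction_relation A S \<longleftrightarrow> (\<forall>s\<in>assignments A.
     (\<forall>a\<in>elts omega. \<forall>b\<in>elts omega.
        (opair (code_mem a b) s \<in> elts S \<longleftrightarrow> app s a \<in> elts (app s b)) \<and>
        (opair (code_eq a b) s \<in> elts S \<longleftrightarrow> app s a = app s b)) \<and>
     (\<forall>f\<in>codes. \<forall>g\<in>codes.
        opair (code_nand f g) s \<in> elts S \<longleftrightarrow> \<not> (opair f s \<in> elts S \<and> opair g s \<in> elts S)) \<and>
     (\<forall>a\<in>elts omega. \<forall>f\<in>codes.
        opair (code_all a f) s \<in> elts S \<longleftrightarrow> (\<forall>x\<in>elts A. opair f (update s a x) \<in> elts S)))"

definition set_sat :: "'v \<Rightarrow> 'v \<Rightarrow> 'v \<Rightarrow> bool" where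
  "set_sat A f s \<longleftrightarrow> (\<exists>S. satisfaction_relation A S \<and> opair f s \<in> elts S)"

definition set_elementary :: "'v \<Rightarrow> 'v \<Rightarrow> 'v \<Rightarrow> bool" where
  "set_elementary i A B \<longleftrightarrow> is_fun i A \<and> (\<forall>x\<in>elts A. app i x \<in> elts B) \<and>
     (\<forall>f\<in>codes. \<forall>s\<in>assignments A. set_sat A f s \<longleftrightarrow> set_sat B f (comp_fun i s))"

text \<open>The critical point of a (class or set) embedding is the least ordinal that is moved.\<close>

definition critical_point :: "('v \<Rightarrow> 'v) \<Rightarrow> 'v \<Rightarrow> bool" where
  "critical_point i \<kappa> \<longleftrightarrow> ordinal \<kappa> \<and> i \<kappa> \<noteq> \<kappa> \<and> (\<forall>\<alpha>\<in>elts \<kappa>. i \<alpha> = \<alpha>)"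

definition critical_cardinal :: "'v \<Rightarrow> bool" where
  "critical_cardinal \<kappa> \<longleftrightarrow> cardinal \<kappa> \<and>
     (\<exists>i N. transitive N \<and> set_elementary i (cumul (succ \<kappa>)) N \<and> critical_point (app i) \<kappa>)"

end


section \<open>Forcing\<close>

locale forcing_structure = set_structure mem
  for mem :: "'v \<Rightarrow> 'v \<Rightarrow> bool" +
  fixes P le one :: 'v
begin

definition leq :: "'v \<Rightarrow> 'v \<Rightarrow> bool" where
  "leq p q \<longleftrightarrow> opair p q \<in> elts le"

text \<open>A forcing notion is a preorder with a distinguished maximum.\<close>

definition forcing_notion :: bool where
  "forcing_notion \<longleftrightarrow>
     (\<forall>z\<in>elts le. \<exists>p\<in>elts P. \<exists>q\<in>elts P. z = opair p q) \<and>
     (\<forall>p\<in>elts P. leq p p) \<and>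
     (\<forall>p\<in>elts P. \<forall>q\<in>elts P. \<forall>r\<in>elts P. leq p q \<longrightarrow> leq q r \<longrightarrow> leq p r) \<and>
     one \<in> elts P \<and> (\<forall>p\<in>elts P. leq p one)"

definition automorphism :: "'v \<Rightarrow> bool" where
  "automorphism \<sigma> \<longleftrightarrow> bij_fun \<sigma> P P \<and>
     (\<forall>p\<in>elts P. \<forall>q\<in>elts P. leq (app \<sigma> p) (app \<sigma> q) \<longleftrightarrow> leq p q) \<and>
     app \<sigma> one = one"

definition automorphism_group :: "'v \<Rightarrow> bool" where
  "automorphism_group K \<longleftrightarrow> (\<forall>\<sigma>\<in>elts K. automorphism \<sigma>) \<and> id_fun P \<in> elts K \<and>
     (\<forall>\<sigma>\<in>elts K. inv_fun \<sigma> \<in> elts K) \<and>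
     (\<forall>\<sigma>\<in>elts K. \<forall>\<rho>\<in>elts K. comp_fun \<sigma> \<rho> \<in> elts K)"


subsection \<open>Names\<close>

text \<open>
  Recursive notions on names are expressed inside \<open>V\<close>, by set-sized approximations living on sets
  that are closed under passing to immediate subnames.  By foundation in \<open>V\<close> the closure condition
  defining \<open>names\<close> is the usual recursive one.
\<close>

definition names :: "'v set" where
  "names = {x. \<exists>t. x \<in> elts t \<and>
     (\<forall>y\<in>elts t. \<forall>z\<in>elts y. \<exists>p\<in>elts P. \<exists>w\<in>elts t. z = opair p w)}"

definition subname_closed :: "'v \<Rightarrow> bool" where
  "subname_closed t \<longleftrightarrow> (\<forall>y\<in>elts t. \<forall>p w. opair p w \<in> elts y \<longrightarrow> w \<in> elts t)"

definition act :: "'v \<Rightarrow> 'v \<Rightarrow> 'v" where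
  "act \<sigma> x = (THE y. \<exists>t f. x \<in> elts t \<and> subname_closed t \<and> is_fun f t \<and>
     (\<forall>u\<in>elts t. elts (app f u) = {opair (app \<sigma> p) (app f w) |p w. opair p w \<in> elts u}) \<and>
     y = app f x)"

definition check :: "'v \<Rightarrow> 'v" where
  "check x = (THE y. \<exists>t f. x \<in> elts t \<and> transitive t \<and> is_fun f t \<and>
     (\<forall>u\<in>elts t. elts (app f u) = {opair one (app f w) |w. w \<in> elts u}) \<and>
     y = app f x)"

definition pair_name :: "'v \<Rightarrow> 'v \<Rightarrow> 'v" where
  "pair_name x y =
     vset {opair one (vset {opair one x}), opair one (vset {opair one x, opair one y})}"


subsection \<open>The forcing relation\<close>

text \<open>
  A sentence of the forcing language is represented by the predicate of being forced by a
  condition.  For equality the recursion is: \<open>p\<close> forces \<open>x = y\<close> iff for all \<open>\<langle>s,z\<rangle> \<in> x\<close> and all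
  \<open>q \<le> p, s\<close> there are \<open>r \<le> q\<close> and \<open>\<langle>s',w\<rangle> \<in> y\<close> with \<open>r \<le> s'\<close> such that \<open>r\<close> forces \<open>z = w\<close>, and
  likewise with \<open>x\<close> and \<open>y\<close> exchanged.  In \<open>feq\<close> the set \<open>R\<close> is the restriction of this relation to \<open>t\<close>.
\<close>

definition eq_half :: "'v \<Rightarrow> 'v \<Rightarrow> 'v \<Rightarrow> 'v \<Rightarrow> bool" where
  "eq_half R p x y \<longleftrightarrow> (\<forall>s z q. opair s z \<in> elts x \<and> leq q p \<and> leq q s \<longrightarrow>
     (\<exists>r s' w. leq r q \<and> opair s' w \<in> elts y \<and> leq r s' \<and> opair r (opair z w) \<in> elts R))"

definition feq :: "'v \<Rightarrow> 'v \<Rightarrow> 'v \<Rightarrow> bool" where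
  "feq x y p \<longleftrightarrow> (\<exists>t R. x \<in> elts t \<and> y \<in> elts t \<and> subname_closed t \<and>
     (\<forall>q\<in>elts P. \<forall>u\<in>elts t. \<forall>v\<in>elts t.
        opair q (opair u v) \<in> elts R \<longleftrightarrow>
          eq_half R q u v \<and> eq_half R q v u) \<and>
     opair p (opair x y) \<in> elts R)"

definition fmem :: "'v \<Rightarrow> 'v \<Rightarrow> 'v \<Rightarrow> bool" where
  "fmem x y p \<longleftrightarrow> (\<forall>q. leq q p \<longrightarrow>
     (\<exists>r s z. leq r q \<and> opair s z \<in> elts y \<and> leq r s \<and> feq x z r))"

definition fnot :: "('v \<Rightarrow> bool) \<Rightarrow> 'v \<Rightarrow> bool" where
  "fnot A p \<longleftrightarrow> (\<forall>q. leq q p \<longrightarrow> \<not> A q)"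

definition fand :: "('v \<Rightarrow> bool) \<Rightarrow> ('v \<Rightarrow> bool) \<Rightarrow> 'v \<Rightarrow> bool" where
  "fand A B p \<longleftrightarrow> A p \<and> B p"

definition fimp :: "('v \<Rightarrow> bool) \<Rightarrow> ('v \<Rightarrow> bool) \<Rightarrow> 'v \<Rightarrow> bool" where
  "fimp A B = fnot (fand A (fnot B))"

definition fiff :: "('v \<Rightarrow> bool) \<Rightarrow> ('v \<Rightarrow> bool) \<Rightarrow> 'v \<Rightarrow> bool" where
  "fiff A B = fand (fimp A B) (fimp B A)"

text \<open>
  The index class \<open>X\<close> is \<open>names\<close> for the quantifiers of the forcing language.  For a ground model
  class \<open>X\<close> it gives quantification over the canonical name of \<open>X\<close>.
\<close>

definition fall :: "'v set \<Rightarrow> ('v \<Rightarrow> 'v \<Rightarrow> bool) \<Rightarrow> 'v \<Rightarrow> bool" where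
  "fall X \<Phi> p \<longleftrightarrow> (\<forall>x\<in>X. \<Phi> x p)"

definition fex :: "'v set \<Rightarrow> ('v \<Rightarrow> 'v \<Rightarrow> bool) \<Rightarrow> 'v \<Rightarrow> bool" where
  "fex X \<Phi> = fnot (fall X (\<lambda>x. fnot (\<Phi> x)))"

definition fball :: "'v \<Rightarrow> ('v \<Rightarrow> 'v \<Rightarrow> bool) \<Rightarrow> 'v \<Rightarrow> bool" where
  "fball a \<Phi> = fall names (\<lambda>x. fimp (fmem x a) (\<Phi> x))"

definition fbex :: "'v \<Rightarrow> ('v \<Rightarrow> 'v \<Rightarrow> bool) \<Rightarrow> 'v \<Rightarrow> bool" where
  "fbex a \<Phi> = fex names (\<lambda>x. fand (fmem x a) (\<Phi> x))"

definition fsubset :: "'v \<Rightarrow> 'v \<Rightarrow> 'v \<Rightarrow> bool" where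
  "fsubset a b = fball a (\<lambda>x. fmem x b)"

definition fpair_in :: "'v \<Rightarrow> 'v \<Rightarrow> 'v \<Rightarrow> 'v \<Rightarrow> bool" where
  "fpair_in x y r = fmem (pair_name x y) r"

definition frelation_on :: "'v \<Rightarrow> 'v \<Rightarrow> 'v \<Rightarrow> bool" where
  "frelation_on r a = fball r (\<lambda>z. fbex a (\<lambda>x. fbex a (\<lambda>y. feq z (pair_name x y))))"

definition forced :: "('v \<Rightarrow> bool) \<Rightarrow> bool" where
  "forced A \<longleftrightarrow> (\<forall>p\<in>elts P. A p)"


subsection \<open>Names for forcing notions and the two-step iteration\<close>

text \<open>
  A name for a forcing notion is a triple of names: for the underlying set \<open>Q\<close>, for the order
  \<open>lq\<close>, and for the maximum \<open>oq\<close>.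
\<close>

definition f_forcing_notion :: "'v \<Rightarrow> 'v \<Rightarrow> 'v \<Rightarrow> 'v \<Rightarrow> bool" where
  "f_forcing_notion Q lq oq =
     fand (frelation_on lq Q)
    (fand (fball Q (\<lambda>x. fpair_in x x lq))
    (fand (fball Q (\<lambda>x. fball Q (\<lambda>y. fball Q (\<lambda>z.
             fimp (fand (fpair_in x y lq) (fpair_in y z lq)) (fpair_in x z lq)))))
    (fand (fmem oq Q)
          (fball Q (\<lambda>x. fpair_in x oq lq)))))"

definition f_automorphism :: "'v \<Rightarrow> 'v \<Rightarrow> 'v \<Rightarrow> 'v \<Rightarrow> 'v \<Rightarrow> bool" where
  "f_automorphism Q lq oq f =
     fand (frelation_on f Q)
    (fand (fball Q (\<lambda>x. fbex Q (\<lambda>y. fpair_in x y f)))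
    (fand (fball Q (\<lambda>y. fbex Q (\<lambda>x. fpair_in x y f)))
    (fand (fball Q (\<lambda>x. fball Q (\<lambda>x'. fball Q (\<lambda>y. fball Q (\<lambda>y'.
             fimp (fand (fpair_in x y f) (fpair_in x' y' f))
                  (fand (fiff (feq x x') (feq y y'))
                        (fiff (fpair_in x x' lq) (fpair_in y y' lq))))))))
          (fpair_in oq oq f))))"

text \<open>For automorphisms \<open>f, g, h\<close> the next sentence says \<open>h = f \<circ> g\<close>.\<close>

definition f_comp :: "'v \<Rightarrow> 'v \<Rightarrow> 'v \<Rightarrow> 'v \<Rightarrow> 'v \<Rightarrow> bool" where
  "f_comp Q f g h = fball Q (\<lambda>x. fball Q (\<lambda>y. fball Q (\<lambda>z.
     fimp (fand (fpair_in x y g) (fpair_in y z f)) (fpair_in x z h))))"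

definition f_automorphism_group :: "'v \<Rightarrow> 'v \<Rightarrow> 'v \<Rightarrow> 'v \<Rightarrow> 'v \<Rightarrow> bool" where
  "f_automorphism_group Q lq oq H =
     fand (fball H (f_automorphism Q lq oq))
    (fand (fbex H (\<lambda>e. fball Q (\<lambda>x. fpair_in x x e)))
    (fand (fball H (\<lambda>f. fbex H (\<lambda>g. fball Q (\<lambda>x. fball Q (\<lambda>y.
             fimp (fpair_in x y f) (fpair_in y x g))))))
          (fball H (\<lambda>f. fball H (\<lambda>g. fbex H (f_comp Q f g))))))"

definition f_filter :: "'v \<Rightarrow> 'v \<Rightarrow> 'v \<Rightarrow> 'v \<Rightarrow> 'v \<Rightarrow> bool" where
  "f_filter Q lq oq h =
     fand (fsubset h Q)
    (fand (fmem oq h)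
    (fand (fball h (\<lambda>x. fball Q (\<lambda>y. fimp (fpair_in x y lq) (fmem y h))))
          (fball h (\<lambda>x. fball h (\<lambda>y. fbex h (\<lambda>z.
             fand (fpair_in z x lq) (fpair_in z y lq)))))))"

definition f_dense_open :: "'v \<Rightarrow> 'v \<Rightarrow> 'v \<Rightarrow> 'v \<Rightarrow> bool" where
  "f_dense_open Q lq d =
     fand (fsubset d Q)
    (fand (fball Q (\<lambda>x. fbex d (\<lambda>y. fpair_in y x lq)))
          (fball d (\<lambda>x. fball Q (\<lambda>y. fimp (fpair_in y x lq) (fmem y d)))))"

text \<open>For an automorphism \<open>f\<close> of \<open>Q\<close> and a subset \<open>d\<close> of \<open>Q\<close>: the pointwise image of \<open>d\<close> is \<open>d\<close>.\<close>

definition f_image_fixed :: "'v \<Rightarrow> 'v \<Rightarrow> 'v \<Rightarrow> 'v \<Rightarrow> bool" where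
  "f_image_fixed Q f d =
     fball Q (\<lambda>x. fball Q (\<lambda>y. fimp (fpair_in x y f) (fiff (fmem x d) (fmem y d))))"

text \<open>
  Conditions of the iteration are identified when \<open>iter_eq\<close> holds: the second coordinates
  are forced to be equal by the common first coordinate.
\<close>

definition iter :: "'v \<Rightarrow> 'v set" where
  "iter Q = {opair p q |p q. p \<in> elts P \<and> q \<in> names \<and> forced (fmem q Q)}"

definition iter_leq :: "'v \<Rightarrow> 'v \<Rightarrow> 'v \<Rightarrow> bool" where
  "iter_leq lq c d \<longleftrightarrow>
     leq (ofst c) (ofst d) \<and> fpair_in (osnd c) (osnd d) lq (ofst c)"

definition iter_eq :: "'v \<Rightarrow> 'v \<Rightarrow> bool" where
  "iter_eq c d \<longleftrightarrow> ofst c = ofst d \<and> feq (osnd c) (osnd d) (ofst c)"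

end


section \<open>Symmetric systems\<close>

locale symmetric_structure = forcing_structure mem P le one
  for mem :: "'v \<Rightarrow> 'v \<Rightarrow> bool" and P le one :: 'v +
  fixes G F :: 'v
begin

definition symmetric_system :: bool where
  "symmetric_system \<longleftrightarrow> forcing_notion \<and> automorphism_group G \<and>
     (\<forall>K\<in>elts F. automorphism_group K \<and> elts K \<subseteq> elts G) \<and> G \<in> elts F \<and>
     (\<forall>K\<in>elts F. \<forall>L. automorphism_group L \<and> elts K \<subseteq> elts L \<and> elts L \<subseteq> elts G \<longrightarrow> L \<in> elts F) \<and>
     (\<forall>K\<in>elts F. \<forall>L\<in>elts F. vset (elts K \<inter> elts L) \<in> elts F) \<and>
     (\<forall>K\<in>elts F. \<forall>\<sigma>\<in>elts G.
        vset ((\<lambda>\<rho>. comp_fun \<sigma> (comp_fun \<rho> (inv_fun \<sigma>))) ` elts K) \<in> elts F)"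

definition system :: "'v" where
  "system = opair (opair P (opair le one)) (opair G F)"

definition sym :: "'v \<Rightarrow> 'v" where
  "sym x = vset {\<sigma> \<in> elts G. act \<sigma> x = x}"

definition HS :: "'v set" where
  "HS = {x. \<exists>t. x \<in> elts t \<and> (\<forall>y\<in>elts t. sym y \<in> elts F \<and>
     (\<forall>z\<in>elts y. \<exists>p\<in>elts P. \<exists>w\<in>elts t. z = opair p w))}"


subsection \<open>The generic semi-direct product\<close>

text \<open>
  For elements \<open>\<langle>\<sigma>,\<rho>\<rangle>\<close>, the product and the action on the iteration are
  \<open>\<langle>\<sigma>,\<rho>\<rangle>\<langle>\<sigma>',\<rho>'\<rangle> = \<langle>\<sigma>\<sigma>', \<sigma>'\<inverse>(\<rho>) \<circ> \<rho>'\<rangle>\<close>, the product being the one for which the action is a group action,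
  and \<open>\<langle>\<sigma>,\<rho>\<rangle>(p,q) = \<langle>\<sigma>p, \<sigma>(\<rho>q)\<rangle>\<close>.  The names for \<open>\<rho>q\<close> and for compositions are determined only up to
  forced equality, so both are given as relations.
\<close>

definition sdp :: "'v \<Rightarrow> 'v set" where
  "sdp H = {opair \<sigma> \<rho> |\<sigma> \<rho>. \<sigma> \<in> elts G \<and> \<rho> \<in> names \<and> forced (fmem \<rho> H)}"

definition sdp_eq :: "'v \<Rightarrow> 'v \<Rightarrow> bool" where
  "sdp_eq a b \<longleftrightarrow> ofst a = ofst b \<and> forced (feq (osnd a) (osnd b))"

definition sdp_mult :: "'v \<Rightarrow> 'v \<Rightarrow> 'v \<Rightarrow> 'v \<Rightarrow> bool" where
  "sdp_mult Q a b c \<longleftrightarrow> ofst c = comp_fun (ofst a) (ofst b) \<and>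
     forced (f_comp Q (act (inv_fun (ofst b)) (osnd a)) (osnd b) (osnd c))"

definition sdp_act :: "'v \<Rightarrow> 'v \<Rightarrow> 'v \<Rightarrow> bool" where
  "sdp_act a c d \<longleftrightarrow> (\<exists>q\<in>names. forced (fpair_in (osnd c) q (osnd a)) \<and>
     iter_eq d (opair (app (ofst a) (ofst c)) (act (ofst a) q)))"

definition sdp_embedding :: "'v \<Rightarrow> 'v \<Rightarrow> 'v \<Rightarrow> bool" where
  "sdp_embedding Q H \<tau> \<longleftrightarrow> is_fun \<tau> G \<and> (\<forall>\<sigma>\<in>elts G. app \<tau> \<sigma> \<in> sdp H) \<and>
     (\<forall>\<sigma>\<in>elts G. \<forall>\<sigma>'\<in>elts G.
        sdp_mult Q (app \<tau> \<sigma>) (app \<tau> \<sigma>') (app \<tau> (comp_fun \<sigma> \<sigma>')) \<and>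
        (sdp_eq (app \<tau> \<sigma>) (app \<tau> \<sigma>') \<longrightarrow> \<sigma> = \<sigma>'))"


subsection \<open>Decomposability\<close>

text \<open>
  The group filter with respect to which \<open>h\<close> is symmetrically generic is \<open>F\<close>, a basis of \<open>j(F)\<close>
  via \<open>j\<close>, acting on \<open>Q\<close> through \<open>\<tau>\<close>: a group \<open>K \<in> F\<close> acts by the second coordinates of the
  \<open>\<tau>(\<sigma>)\<close> for \<open>\<sigma> \<in> K\<close>.
\<close>

definition f_symmetrically_dense_open :: "'v \<Rightarrow> 'v \<Rightarrow> 'v \<Rightarrow> 'v \<Rightarrow> 'v \<Rightarrow> bool" where
  "f_symmetrically_dense_open Q lq \<tau> d =
     fand (f_dense_open Q lq d)
          (fex (elts F) (\<lambda>K. fall (elts K) (\<lambda>\<sigma>. f_image_fixed Q (osnd (app \<tau> \<sigma>)) d)))"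

definition f_symmetrically_generic ::
  "'v set \<Rightarrow> 'v \<Rightarrow> 'v \<Rightarrow> 'v \<Rightarrow> 'v \<Rightarrow> 'v \<Rightarrow> 'v \<Rightarrow> bool" where
  "f_symmetrically_generic M Q lq oq \<tau> h =
     fand (f_filter Q lq oq h)
          (fall M (\<lambda>d. fimp (f_symmetrically_dense_open Q lq \<tau> (check d))
                            (fbex h (\<lambda>x. fmem x (check d)))))"

definition below :: "('v \<Rightarrow> 'v) \<Rightarrow> 'v \<Rightarrow> 'v" where
  "below j m = vset {r \<in> elts (j P). opair r m \<in> elts (j le)}"

definition decomposing_isomorphism ::
  "('v \<Rightarrow> 'v) \<Rightarrow> 'v \<Rightarrow> 'v \<Rightarrow> 'v \<Rightarrow> 'v \<Rightarrow> 'v \<Rightarrow> bool" where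
  "decomposing_isomorphism j m Q lq oq \<pi> \<longleftrightarrow> is_fun \<pi> (below j m) \<and>
     (\<forall>r\<in>elts (below j m). app \<pi> r \<in> iter Q) \<and>
     (\<forall>c\<in>iter Q. \<exists>r\<in>elts (below j m). iter_eq (app \<pi> r) c) \<and>
     (\<forall>r\<in>elts (below j m). \<forall>s\<in>elts (below j m).
        (iter_eq (app \<pi> r) (app \<pi> s) \<longrightarrow> r = s) \<and>
        (opair r s \<in> elts (j le) \<longleftrightarrow> iter_leq lq (app \<pi> r) (app \<pi> s))) \<and>
     (\<forall>p\<in>elts P. j p \<in> elts (below j m) \<and> iter_eq (app \<pi> (j p)) (opair p oq))"

definition transports ::
  "('v \<Rightarrow> 'v) \<Rightarrow> 'v \<Rightarrow> 'v \<Rightarrow> 'v \<Rightarrow> bool" where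
  "transports j m \<pi> \<tau> \<longleftrightarrow> (\<forall>\<sigma>\<in>elts G. ofst (app \<tau> \<sigma>) = \<sigma> \<and>
     (\<forall>r\<in>elts (below j m). app (j \<sigma>) r \<in> elts (below j m) \<and>
        sdp_act (app \<tau> \<sigma>) (app \<pi> r) (app \<pi> (app (j \<sigma>) r))))"

definition j_decomposable :: "('v \<Rightarrow> 'v) \<Rightarrow> 'v set \<Rightarrow> bool" where
  "j_decomposable j M \<longleftrightarrow> (\<exists>m Q lq oq \<pi> h H \<tau>.
     m \<in> elts (j P) \<and>
     Q \<in> HS \<and> lq \<in> HS \<and> oq \<in> HS \<and> sym Q = G \<and> sym lq = G \<and> sym oq = G \<and>
     forced (f_forcing_notion Q lq oq) \<and>
     decomposing_isomorphism j m Q lq oq \<pi> \<and>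
     h \<in> HS \<and> forced (f_symmetrically_generic M Q lq oq \<tau> h) \<and>
     H \<in> HS \<and> forced (f_automorphism_group Q lq oq H) \<and> sym H = G \<and>
     sdp_embedding Q H \<tau> \<and> transports j m \<pi> \<tau> \<and>
     (\<forall>\<sigma>\<in>elts G. forced (f_image_fixed Q (osnd (app \<tau> \<sigma>)) h)) \<and>
     (\<forall>K\<in>elts F. j K \<in> elts (j F)) \<and>
     (\<forall>L\<in>elts (j F). \<exists>K\<in>elts F. elts (j K) \<subseteq> elts L))"

end

end

theory Submission
  imports Defs
begin

text \<open>
  An induction on the levels of \<open>V\<^sub>\<kappa>\<close> shows that \<open>j\<close> is the identity on \<open>V\<^sub>\<kappa>\<close>.  Hence \<open>j\<close> fixes
  the forcing notion, the group, the filter and all their elements, and the system is decomposed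
  with \<open>m = 1\<close> and the name of the trivial forcing notion \<open>{0}\<close>, whose only symmetrically generic
  filter is \<open>{0}\<close> itself.
\<close>

text \<open>The universe may be ill-founded from outside, so an induction is an appeal to foundation
  inside \<open>V\<close>, and it is legitimate only for a definable predicate. Hence the calculus
  of definability with parameters. It admits \<open>j\<close> in formulas, because the induction
  along the levels speaks of \<open>j\<close>.

  Elementarity, by contrast, concerns only pure formulas, evaluated in \<open>M\<close> on the
  target side. A level is therefore not transferred alone but together with a function
  \<open>f\<close> that lists the levels: two pure formulas about \<open>f\<close> bound
  \<open>j\<close> of a level by the level itself.

  On the forcing side the proof works with the forcing relation alone. Forced equality is given by
  set-sized approximations, so that it is an equivalence relation on names must be derived inside
  \<open>V\<close>. The names chosen for the decomposition carry only the condition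
  \<open>one\<close>: automorphisms fix them, and the clauses about the trivial forcing notion
  become density arguments about names that are forced equal to \<open>0\<close>.\<close>

section \<open>Renaming the variables of formulas\<close>

primrec ren :: "(nat \<Rightarrow> nat) \<Rightarrow> fm \<Rightarrow> fm" where
  "ren r (Memb a b) = Memb (r a) (r b)"
| "ren r (Equal a b) = Equal (r a) (r b)"
| "ren r (Emb a b) = Emb (r a) (r b)"
| "ren r (Tgt a) = Tgt (r a)"
| "ren r (Neg \<phi>) = Neg (ren r \<phi>)"
| "ren r (Conj \<phi> \<psi>) = Conj (ren r \<phi>) (ren r \<psi>)"
| "ren r (Univ a \<phi>) = Univ (r a) (ren r \<phi>)"

text \<open>Injectivity handles the quantifier: an update at \<open>r a\<close> is seen through
  \<open>r\<close> only at \<open>a\<close>, so renamed bound variables capture nothing. The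
  renamings below move arguments and parameters to the places where another formula or an axiom
  expects them.\<close>

lemma sat_ren:
  assumes "inj r"
  shows "sat mem j M D (ren r \<phi>) s \<longleftrightarrow> sat mem j M D \<phi> (s \<circ> r)"
proof (induction \<phi> arbitrary: s)
  case (Univ a \<phi>)
  have "s(r a := x) \<circ> r = (s \<circ> r)(a := x)" for x
    using assms by (auto simp: fun_eq_iff inj_def)
  with Univ show ?case by (simp only: sat.simps ren.simps)
qed auto

locale zf_model = set_structure mem
  for mem :: "'v \<Rightarrow> 'v \<Rightarrow> bool" +
  fixes j :: "'v \<Rightarrow> 'v" and M :: "'v set"
  assumes ZF: "models_ZF j M"
begin

section \<open>Definability\<close>

text \<open>Even variables carry the arguments of a predicate, odd variables its parameters.
  This leaves room for merging the parameters of two formulas.\<close>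

definition slots :: "(nat \<Rightarrow> 'v) \<Rightarrow> (nat \<Rightarrow> 'v) \<Rightarrow> nat \<Rightarrow> 'v" where
  "slots s e n = (if even n then s (n div 2) else e (n div 2))"

definition definable :: "((nat \<Rightarrow> 'v) \<Rightarrow> bool) \<Rightarrow> bool" where
  "definable A \<longleftrightarrow> (\<exists>\<phi> e. \<forall>s. A s \<longleftrightarrow> sat mem j M UNIV \<phi> (slots s e))"

text \<open>A term is represented by its graph, with the value in argument 0 and the other arguments
  shifted by one. Binders use the same shift, so the rules in \<open>definable_intros\<close>
  compose mechanically.\<close>

definition fterm :: "((nat \<Rightarrow> 'v) \<Rightarrow> 'v) \<Rightarrow> bool" where
  "fterm t \<longleftrightarrow> definable (\<lambda>s. s 0 = t (\<lambda>n. s (Suc n)))"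

named_theorems definable_intros

lemma definable_not [definable_intros]: "definable A \<Longrightarrow> definable (\<lambda>s. \<not> A s)"
  unfolding definable_def by (metis sat.simps(5))

lemma definable_subst:
  assumes "definable A" "inj f"
  shows "definable (\<lambda>s. A (\<lambda>n. s (f n)))"
proof -
  obtain \<phi> e where \<phi>: "\<And>s. A s \<longleftrightarrow> sat mem j M UNIV \<phi> (slots s e)"
    using assms unfolding definable_def by blast
  define r where "r n = (if even n then 2 * f (n div 2) else n)" for n
  have "inj r"
  proof (rule injI)
    fix m n assume "r m = r n"
    moreover from this have "even m \<longleftrightarrow> even n"
      unfolding r_def by presburger
    ultimately show "m = n" using injD [OF assms(2), of "m div 2" "n div 2"]
      by (auto simp: r_def elim!: evenE)
  qed
  moreover have "slots s e \<circ> r = slots (\<lambda>n. s (f n)) e" for s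
    by (auto simp: slots_def r_def fun_eq_iff)
  ultimately have "A (\<lambda>n. s (f n)) \<longleftrightarrow> sat mem j M UNIV (ren r \<phi>) (slots s e)" for s
    by (simp add: sat_ren \<phi>)
  then show ?thesis unfolding definable_def by blast
qed

lemma definable_conj [definable_intros]:
  assumes "definable A" "definable B"
  shows "definable (\<lambda>s. A s \<and> B s)"
proof -
  obtain \<phi> e where \<phi>: "\<And>s. A s \<longleftrightarrow> sat mem j M UNIV \<phi> (slots s e)"
    using assms unfolding definable_def by blast
  obtain \<psi> d where \<psi>: "\<And>s. B s \<longleftrightarrow> sat mem j M UNIV \<psi> (slots s d)"
    using assms unfolding definable_def by blast
  \<comment> \<open>Both parameter lists are interleaved in the odd variables: parameter
    \<open>k\<close> of \<open>A\<close> moves to variable \<open>4 * k + 1\<close>, parameter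
    \<open>k\<close> of \<open>B\<close> to variable \<open>4 * k + 3\<close>.\<close>
  define r where "r n = (if even n then n else 2 * n - 1)" for n :: nat
  define q where "q n = (if even n then n else 2 * n + 1)" for n :: nat
  define c where "c n = (if even n then e (n div 2) else d (n div 2))" for n
  have "inj r" "inj q"
    by (rule injI, simp add: r_def q_def split: if_splits; presburger)+
  moreover have "(slots s c \<circ> r) n = slots s e n" "(slots s c \<circ> q) n = slots s d n" for s n
    by (cases "even n"; force simp: slots_def r_def q_def c_def elim!: oddE)+
  then have "slots s c \<circ> r = slots s e" "slots s c \<circ> q = slots s d" for s
    by blast+
  ultimately have "A s \<and> B s \<longleftrightarrow> sat mem j M UNIV (Conj (ren r \<phi>) (ren q \<psi>)) (slots s c)" for s
    by (simp add: sat_ren \<phi> \<psi>)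
  then show ?thesis unfolding definable_def by blast
qed

lemma definable_all [definable_intros]:
  assumes "definable (\<lambda>s. A (\<lambda>n. s (Suc n)) (s 0))"
  shows "definable (\<lambda>s. \<forall>x. A s x)"
proof -
  obtain \<phi> e where \<phi>: "\<And>s. A (\<lambda>n. s (Suc n)) (s 0) \<longleftrightarrow> sat mem j M UNIV \<phi> (slots s e)"
    using assms unfolding definable_def by metis
  \<comment> \<open>The quantified argument leaves variable 0 for variable 1. The parameters move up
    by one place to free that variable, and the remaining arguments move down by one. The
    \<open>undefined\<close> in \<open>c\<close> is overwritten by the quantifier.\<close>
  define r where "r n = (if n = 0 then 1 else if even n then n - 2 else n + 2)" for n :: nat
  have "inj r"
    by (rule injI, simp add: r_def split: if_splits; presburger)
  define c where "c = case_nat undefined e"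
  have "(slots s c)(1 := x) \<circ> r = slots (case_nat x s) e" for s x
    by (auto simp: slots_def r_def c_def fun_eq_iff elim!: evenE split: nat.splits)
  then have "A s x \<longleftrightarrow> sat mem j M UNIV (ren r \<phi>) ((slots s c)(1 := x))" for s x
    using \<phi> [of "case_nat x s"] \<open>inj r\<close> by (simp add: sat_ren)
  then have "(\<forall>x. A s x) \<longleftrightarrow> sat mem j M UNIV (Univ 1 (ren r \<phi>)) (slots s c)" for s
    by simp
  then show ?thesis unfolding definable_def by blast
qed

lemma definable_imp [definable_intros]:
  assumes "definable A" "definable B"
  shows "definable (\<lambda>s. A s \<longrightarrow> B s)"
  using definable_not [OF definable_conj [OF assms(1) definable_not [OF assms(2)]]]
  by (simp only: de_Morgan_conj not_not imp_conv_disj)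

lemma definable_disj [definable_intros]:
  "definable A \<Longrightarrow> definable B \<Longrightarrow> definable (\<lambda>s. A s \<or> B s)"
  unfolding disj_imp by (intro definable_imp definable_not)

lemma definable_iff [definable_intros]:
  "definable A \<Longrightarrow> definable B \<Longrightarrow> definable (\<lambda>s. A s \<longleftrightarrow> B s)"
  unfolding iff_conv_conj_imp by (intro definable_conj definable_imp)

lemma definable_ex [definable_intros]:
  assumes "definable (\<lambda>s. A (\<lambda>n. s (Suc n)) (s 0))"
  shows "definable (\<lambda>s. \<exists>x. A s x)"
  using definable_not [OF definable_all [of "\<lambda>s x. \<not> A s x", OF definable_not [OF assms]]]
  by (simp only: not_all not_not)

lemma fterm_const [definable_intros]: "fterm (\<lambda>s. c)"
proof -
  have "s 0 = c \<longleftrightarrow> sat mem j M UNIV (Equal 0 1) (slots s (\<lambda>n. c))" for s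
    by (simp add: slots_def)
  then show ?thesis unfolding fterm_def definable_def by blast
qed

lemma fterm_var [definable_intros]: "fterm (\<lambda>s. s i)"
proof -
  have "s 0 = s (Suc i) \<longleftrightarrow> sat mem j M UNIV (Equal 0 (2 * Suc i)) (slots s e)" for s e
    by (simp add: slots_def)
  then show ?thesis unfolding fterm_def definable_def by blast
qed

text \<open>This is the shift that a term undergoes below a binder: in its graph, a fresh argument
  is inserted right after the value.\<close>

lemma fterm_weaken:
  assumes "fterm t"
  shows "fterm (\<lambda>s. t (\<lambda>n. s (Suc n)))"
proof -
  let ?f = "\<lambda>n. if n = 0 then 0 else Suc n"
  have "inj ?f" by (auto simp: inj_def)
  from definable_subst [OF assms [unfolded fterm_def] this]
  show ?thesis unfolding fterm_def by simp
qed

text \<open>Formulas have no terms, so terms are substituted by quantifying over their values. A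
  relation thus has to be treated only for two plain variables.\<close>

lemma definable_rel:
  assumes R: "definable (\<lambda>s. R (s 0) (s 1))" and "fterm t" "fterm u"
  shows "definable (\<lambda>s. R (t s) (u s))"
proof -
  have *: "definable (\<lambda>s. \<exists>y. y = u s \<and> (\<exists>x. x = t s \<and> R x y))"
    using R assms(2,3) fterm_weaken [of t] unfolding fterm_def
    by (intro definable_ex definable_conj) simp_all
  have "(\<lambda>s. \<exists>y. y = u s \<and> (\<exists>x. x = t s \<and> R x y)) = (\<lambda>s. R (t s) (u s))"
    by simp
  with * show ?thesis by (simp only:)
qed

lemma definable_mem [definable_intros]:
  assumes "fterm t" "fterm u"
  shows "definable (\<lambda>s. mem (t s) (u s))"
proof (rule definable_rel [OF _ assms])
  have "mem (s 0) (s 1) \<longleftrightarrow> sat mem j M UNIV (Memb 0 2) (slots s e)" for s e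
    by (simp add: slots_def)
  then show "definable (\<lambda>s. mem (s 0) (s 1))" unfolding definable_def by blast
qed

lemma definable_eq [definable_intros]:
  assumes "fterm t" "fterm u"
  shows "definable (\<lambda>s. t s = u s)"
  by (rule definable_rel [OF _ assms]) (use fterm_var [of 0] in \<open>simp add: fterm_def\<close>)

lemma fterm_j [definable_intros]:
  assumes "fterm t"
  shows "fterm (\<lambda>s. j (t s))"
proof -
  have "s 1 = j (s 0) \<longleftrightarrow> sat mem j M UNIV (Emb 0 2) (slots s e)" for s e
    by (auto simp: slots_def)
  then have "definable (\<lambda>s. s 1 = j (s 0))" unfolding definable_def by blast
  from definable_rel [where R = "\<lambda>x y. y = j x", OF this fterm_weaken [OF assms] fterm_var [of 0]]
  show ?thesis unfolding fterm_def .
qed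

lemma definable_elts [definable_intros]:
  "fterm t \<Longrightarrow> fterm u \<Longrightarrow> definable (\<lambda>s. t s \<in> elts (u s))"
  unfolding elts_def mem_Collect_eq by (rule definable_mem)

lemma definable_ball [definable_intros]:
  "fterm t \<Longrightarrow> definable (\<lambda>s. A (\<lambda>n. s (Suc n)) (s 0)) \<Longrightarrow> definable (\<lambda>s. \<forall>x\<in>elts (t s). A s x)"
  unfolding Ball_def
  by (rule definable_all, rule definable_imp, rule definable_elts, rule fterm_var, erule fterm_weaken)

lemma definable_bex [definable_intros]:
  "fterm t \<Longrightarrow> definable (\<lambda>s. A (\<lambda>n. s (Suc n)) (s 0)) \<Longrightarrow> definable (\<lambda>s. \<exists>x\<in>elts (t s). A s x)"
  unfolding Bex_def
  by (rule definable_ex, rule definable_conj, rule definable_elts, rule fterm_var, erule fterm_weaken)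

lemma definable_subset [definable_intros]:
  "fterm t \<Longrightarrow> fterm u \<Longrightarrow> definable (\<lambda>s. elts (t s) \<subseteq> elts (u s))"
  unfolding subset_eq
  by (rule definable_ball, assumption, rule definable_elts, rule fterm_var, erule fterm_weaken)

section \<open>Basic set theory\<close>

lemmas ZF_ext = ZF [unfolded models_ZF_def, THEN conjunct1]
  and ZF_1 = ZF [unfolded models_ZF_def, THEN conjunct2]
lemmas ZF_foundation = ZF_1 [THEN conjunct1] and ZF_2 = ZF_1 [THEN conjunct2]
lemmas ZF_pairing = ZF_2 [THEN conjunct1] and ZF_3 = ZF_2 [THEN conjunct2]
lemmas ZF_union = ZF_3 [THEN conjunct1] and ZF_4 = ZF_3 [THEN conjunct2]
lemmas ZF_power = ZF_4 [THEN conjunct1] and ZF_5 = ZF_4 [THEN conjunct2]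
lemmas ZF_infinity = ZF_5 [THEN conjunct1] and ZF_6 = ZF_5 [THEN conjunct2]
lemmas ZF_separation = ZF_6 [THEN conjunct1] and ZF_replacement = ZF_6 [THEN conjunct2]

lemma extensionality: "elts x = elts y \<Longrightarrow> x = y"
  by (rule ZF_ext [rule_format])

lemma ex_minimal:
  assumes "elts x \<noteq> {}"
  obtains y where "y \<in> elts x" "elts y \<inter> elts x = {}"
  using ZF_foundation [rule_format, OF assms] by (elim bexE)

lemma vset_eqI: "elts z = A \<Longrightarrow> vset A = z"
  unfolding vset_def by (rule the_equality) (simp_all add: extensionality)

lemma vset_elts [simp]: "vset (elts x) = x"
  by (rule vset_eqI) simp

text \<open>\<open>vset\<close> is a definite description and says something only about extensions
  of sets. Each construction below therefore needs its own existence proof before its elements can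
  be computed.\<close>

lemma elts_vset: "\<exists>z. elts z = A \<Longrightarrow> elts (vset A) = A"
  by (elim exE) (simp add: vset_eqI)

lemma elts_vset_separation:
  assumes "definable (\<lambda>s. A (s 0))"
  shows "elts (vset {a \<in> elts x. A a}) = {a \<in> elts x. A a}"
proof (rule elts_vset)
  obtain \<phi> e where \<phi>: "\<And>s. A (s 0) \<longleftrightarrow> sat mem j M UNIV \<phi> (slots s e)"
    using assms unfolding definable_def by blast
  have "A a \<longleftrightarrow> sat mem j M UNIV \<phi> ((slots (\<lambda>n. a) e)(0 := a))" for a
    using \<phi> [of "\<lambda>n. a"] by (simp add: slots_def fun_upd_idem)
  have eq: "A a \<longleftrightarrow> sat mem j M UNIV \<phi> ((slots (\<lambda>n. undefined) e)(0 := a))" for a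
  proof -
    have "(slots (\<lambda>n. undefined) e)(0 := a) = slots ((\<lambda>n. undefined)(0 := a)) e"
      by (auto simp: slots_def fun_eq_iff elim!: evenE)
    then show ?thesis using \<phi> [of "(\<lambda>n. undefined)(0 := a)"] by simp
  qed
  have "\<exists>y. elts y = {a \<in> elts x. sat mem j M UNIV \<phi> ((slots (\<lambda>n. undefined) e)(0 := a))}"
    using ZF_separation by blast
  then show "\<exists>z. elts z = {a \<in> elts x. A a}" unfolding eq .
qed

lemma replacement:
  assumes "definable (\<lambda>s. A (s 0) (s 1))" and unique: "\<And>a. a \<in> elts x \<Longrightarrow> \<exists>!b. A a b"
  shows "\<exists>y. elts y = {b. \<exists>a\<in>elts x. A a b}"
proof -
  obtain \<phi> e where \<phi>: "\<And>s. A (s 0) (s 1) \<longleftrightarrow> sat mem j M UNIV \<phi> (slots s e)"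
    using assms unfolding definable_def by blast
  \<comment> \<open>The replacement schema expects its arguments in variables 0 and 1, whereas
    \<open>slots\<close> keeps them in variables 0 and 2.\<close>
  define r where "r = (\<lambda>n::nat. n)(1 := 2, 2 := 1)"
  have "inj r" by (auto simp: inj_def r_def)
  define s where "s = slots (\<lambda>n. undefined) e \<circ> r"
  have eq: "A a b \<longleftrightarrow> sat mem j M UNIV (ren r \<phi>) (s(0 := a, 1 := b))" for a b
  proof -
    have "s(0 := a, 1 := b) \<circ> r = slots ((\<lambda>n. undefined)(0 := a, 1 := b)) e"
      by (auto simp: s_def r_def slots_def fun_eq_iff elim!: evenE)
    then show ?thesis using \<phi> [of "(\<lambda>n. undefined)(0 := a, 1 := b)"] \<open>inj r\<close>
      by (simp add: sat_ren)
  qed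
  have "(\<forall>a\<in>elts x. \<exists>!b. sat mem j M UNIV (ren r \<phi>) (s(0 := a, 1 := b))) \<longrightarrow>
        (\<exists>y. elts y = {b. \<exists>a\<in>elts x. sat mem j M UNIV (ren r \<phi>) (s(0 := a, 1 := b))})"
    by (rule ZF_replacement [THEN spec, THEN spec, THEN spec])
  then show ?thesis using unique unfolding eq by blast
qed

lemma elts_vset_pair [simp]: "elts (vset {x, y}) = {x, y}"
  using ZF_pairing by (intro elts_vset) blast

lemma elts_vset_singleton [simp]: "elts (vset {x}) = {x}"
  using elts_vset_pair [of x x] by simp

lemma elts_vset_empty [simp]: "elts (vset {}) = {}"
proof (rule elts_vset)
  show "\<exists>z. elts z = {}" using ZF_infinity by blast
qed

lemma elts_vset_Union: "elts (vset (\<Union>y\<in>elts x. elts y)) = (\<Union>y\<in>elts x. elts y)"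
  using ZF_union by (intro elts_vset) blast

lemma elts_vset_Pow: "elts (vset {y. elts y \<subseteq> elts x}) = {y. elts y \<subseteq> elts x}"
  using ZF_power by (intro elts_vset) blast

lemma elts_vset_Un: "elts (vset (elts x \<union> elts y)) = elts x \<union> elts y"
  using elts_vset_Union [of "vset {x, y}"] by simp

lemma elts_vset_insert: "elts (vset (insert a (elts x))) = insert a (elts x)"
  using elts_vset_Un [of "vset {a}" x] by simp

lemma vset_pair_eq: "vset {a, b} = vset {c, d} \<longleftrightarrow> a = c \<and> b = d \<or> a = d \<and> b = c"
proof -
  have "vset {a, b} = vset {c, d} \<longleftrightarrow> {a, b} = {c, d}"
    by (metis elts_vset_pair)
  then show ?thesis by (simp add: doubleton_eq_iff)
qed

lemma opair_eq [simp]: "opair a b = opair c d \<longleftrightarrow> a = c \<and> b = d"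
proof -
  have "vset {x} = vset {x, x}" for x by simp
  then show ?thesis unfolding opair_def vset_pair_eq by (auto simp only: vset_pair_eq)
qed

lemma ofst_opair [simp]: "ofst (opair a b) = a"
  unfolding ofst_def by (rule the_equality) auto

lemma osnd_opair [simp]: "osnd (opair a b) = b"
  unfolding osnd_def by (rule the_equality) auto

lemma fterm_pair [definable_intros]:
  assumes "fterm t" "fterm u"
  shows "fterm (\<lambda>s. vset {t s, u s})"
proof -
  have *: "x = vset {y, z} \<longleftrightarrow> (\<forall>w. w \<in> elts x \<longleftrightarrow> w = y \<or> w = z)" for x y z
  proof
    assume "\<forall>w. w \<in> elts x \<longleftrightarrow> w = y \<or> w = z"
    then have "elts x = {y, z}" by auto
    then show "x = vset {y, z}" by (simp add: vset_eqI)
  qed simp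
  have "definable (\<lambda>s. \<forall>w. w \<in> elts (s 0) \<longleftrightarrow> w = t (\<lambda>n. s (Suc n)) \<or> w = u (\<lambda>n. s (Suc n)))"
    by (rule definable_all definable_iff definable_elts definable_disj definable_eq fterm_var
      | rule fterm_weaken, rule fterm_weaken, rule assms)+
  then show ?thesis unfolding fterm_def * .
qed

lemma fterm_opair [definable_intros]:
  assumes "fterm t" "fterm u"
  shows "fterm (\<lambda>s. opair (t s) (u s))"
proof -
  have "fterm (\<lambda>s. vset {vset {t s, t s}, vset {t s, u s}})"
    by (intro fterm_pair assms)
  then show ?thesis unfolding opair_def by (simp only: insert_absorb2)
qed

lemma opair_graph:
  assumes "fterm (\<lambda>s. t (s 0))"
  shows "elts (vset {opair a (t a) |a. a \<in> elts x}) = {opair a (t a) |a. a \<in> elts x}"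
proof -
  have "definable (\<lambda>s. s 1 = opair (s 0) (t (s 0)))"
    by (intro definable_eq fterm_opair fterm_var) (use assms in simp)
  from replacement [OF this, of x]
  have "\<exists>y. elts y = {b. \<exists>a\<in>elts x. b = opair a (t a)}" by simp
  then show ?thesis
    by (intro elts_vset) (simp add: Bex_def conj_commute)
qed

text \<open>Supplies the functions given by a term: the identity that computes \<open>act\<close>,
  and the maps \<open>\<pi>\<close> and \<open>\<tau>\<close> of the decomposition.\<close>

lemma is_fun_graph:
  assumes "fterm (\<lambda>s. t (s 0))"
  shows "is_fun (vset {opair a (t a) |a. a \<in> elts x}) x"
    and "a \<in> elts x \<Longrightarrow> app (vset {opair a (t a) |a. a \<in> elts x}) a = t a"
  using opair_graph [OF assms, of x] unfolding is_fun_def app_def by auto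

lemma is_fun_domain:
  assumes "is_fun f a" "opair x y \<in> elts f"
  shows "x \<in> elts a"
proof -
  obtain x' y' where "x' \<in> elts a" "opair x y = opair x' y'"
    using assms unfolding is_fun_def by meson
  then show ?thesis by simp
qed

lemma is_fun_ex1: "is_fun f a \<Longrightarrow> x \<in> elts a \<Longrightarrow> \<exists>!y. opair x y \<in> elts f"
  unfolding is_fun_def by (elim conjE, erule (1) bspec)

lemma app_equality: "is_fun f a \<Longrightarrow> opair x y \<in> elts f \<Longrightarrow> app f x = y"
  unfolding app_def using is_fun_ex1 [OF _ is_fun_domain] by (rule the1_equality)

lemma opair_app: "is_fun f a \<Longrightarrow> x \<in> elts a \<Longrightarrow> opair x (app f x) \<in> elts f"
  unfolding app_def by (rule theI') (rule is_fun_ex1)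

lemma elts_succ [simp]: "elts (succ a) = insert a (elts a)"
  unfolding succ_def by (rule elts_vset_insert)

text \<open>Foundation applied to the set of counterexamples in \<open>x\<close>, which exists by
  definability. The induction hypothesis is confined to elements that lie in \<open>x\<close> again,
  so \<open>x\<close> need not be transitive.\<close>

lemma minimal_counterexample:
  assumes "definable (\<lambda>s. \<not> A (s 0))" "a \<in> elts x"
    and step: "\<And>y. y \<in> elts x \<Longrightarrow> (\<And>z. z \<in> elts y \<Longrightarrow> z \<in> elts x \<Longrightarrow> A z) \<Longrightarrow> A y"
  shows "A a"
proof (rule ccontr)
  assume "\<not> A a"
  note bad = elts_vset_separation [OF assms(1), of x]
  with \<open>\<not> A a\<close> assms(2) have "elts (vset {a \<in> elts x. \<not> A a}) \<noteq> {}" by auto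
  then obtain y where "y \<in> elts x" "\<not> A y" "\<And>z. z \<in> elts y \<Longrightarrow> z \<in> elts x \<Longrightarrow> A z"
    using ex_minimal bad by (metis (no_types, lifting) IntI empty_iff mem_Collect_eq)
  then show False using step by blast
qed


lemma fterm_succ [definable_intros]:
  assumes "fterm t"
  shows "fterm (\<lambda>s. succ (t s))"
proof -
  have *: "x = succ y \<longleftrightarrow> (\<forall>w. w \<in> elts x \<longleftrightarrow> w = y \<or> w \<in> elts y)" for x y
  proof
    assume "\<forall>w. w \<in> elts x \<longleftrightarrow> w = y \<or> w \<in> elts y"
    then have "elts x = insert y (elts y)" by auto
    then show "x = succ y" by (intro extensionality) simp
  qed simp
  have "definable (\<lambda>s. \<forall>w. w \<in> elts (s 0) \<longleftrightarrow> w = t (\<lambda>n. s (Suc n)) \<or> w \<in> elts (t (\<lambda>n. s (Suc n))))"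
    by (rule definable_all definable_iff definable_elts definable_disj definable_eq fterm_var
      | rule fterm_weaken, rule fterm_weaken, rule assms)+
  then show ?thesis unfolding fterm_def * .
qed

section \<open>The cumulative hierarchy\<close>

text \<open>The recursion from \<open>cumul\<close> with \<open>app\<close> replaced by membership
  of pairs. In this form its definability is a matter of applying the introduction rules;
  \<open>cumulative_iff\<close> leads back to \<open>app\<close>.\<close>

definition cumulative :: "'v \<Rightarrow> 'v \<Rightarrow> bool" where
  "cumulative f \<alpha> \<longleftrightarrow> is_fun f (succ \<alpha>) \<and>
     (\<forall>\<beta>\<in>elts (succ \<alpha>). \<forall>v. opair \<beta> v \<in> elts f \<longrightarrow>
        (\<forall>x. x \<in> elts v \<longleftrightarrow> (\<exists>\<gamma>\<in>elts \<beta>. \<exists>w. opair \<gamma> w \<in> elts f \<and> elts x \<subseteq> elts w)))"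

lemma cumulative_is_fun: "cumulative f \<alpha> \<Longrightarrow> is_fun f (succ \<alpha>)"
  unfolding cumulative_def by (elim conjE)

lemma mem_cumulative_iff:
  assumes "cumulative f \<alpha>" "opair \<beta> v \<in> elts f"
  shows "x \<in> elts v \<longleftrightarrow> (\<exists>\<gamma>\<in>elts \<beta>. \<exists>w. opair \<gamma> w \<in> elts f \<and> elts x \<subseteq> elts w)"
  by (rule assms(1) [unfolded cumulative_def, THEN conjunct2, THEN bspec,
      OF is_fun_domain [OF cumulative_is_fun [OF assms(1)] assms(2)],
      THEN spec, THEN mp, OF assms(2), THEN spec])

lemma ordinal_mem_succ_trans:
  assumes "ordinal \<alpha>" "\<beta> \<in> elts (succ \<alpha>)" "\<gamma> \<in> elts \<beta>"
  shows "\<gamma> \<in> elts \<alpha>"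
  using assms unfolding ordinal_def transitive_def by auto

lemma ordinal_mem: "ordinal \<alpha> \<Longrightarrow> \<beta> \<in> elts \<alpha> \<Longrightarrow> ordinal \<beta>"
  unfolding ordinal_def transitive_def by blast

text \<open>The approximations may have different lengths, so the induction is on the common
  argument: below it they contain the same pairs, and these determine the value.\<close>

lemma cumulative_unique:
  assumes \<alpha>: "ordinal \<alpha>" "cumulative f \<alpha>" and \<alpha>': "ordinal \<alpha>'" "cumulative f' \<alpha>'"
    and v: "opair \<beta> v \<in> elts f" and v': "opair \<beta> v' \<in> elts f'"
  shows "v = v'"
proof -
  note dom = is_fun_domain [OF cumulative_is_fun [OF \<alpha>(2)]]
    and dom' = is_fun_domain [OF cumulative_is_fun [OF \<alpha>'(2)]]
  note ex = opair_app [OF cumulative_is_fun [OF \<alpha>(2)]]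
    and ex' = opair_app [OF cumulative_is_fun [OF \<alpha>'(2)]]
  have "\<forall>v v'. opair \<beta> v \<in> elts f \<longrightarrow> opair \<beta> v' \<in> elts f' \<longrightarrow> v = v'"
  proof (rule minimal_counterexample [of _ \<beta> "succ \<alpha>"])
    show "definable (\<lambda>s. \<not> (\<forall>v v'. opair (s 0) v \<in> elts f \<longrightarrow> opair (s 0) v' \<in> elts f' \<longrightarrow> v = v'))"
      by (rule definable_intros)+
    show "\<beta> \<in> elts (succ \<alpha>)" using v by (rule dom)
  next
    fix \<beta> assume IH: "\<And>\<gamma>. \<gamma> \<in> elts \<beta> \<Longrightarrow> \<gamma> \<in> elts (succ \<alpha>) \<Longrightarrow>
        \<forall>v v'. opair \<gamma> v \<in> elts f \<longrightarrow> opair \<gamma> v' \<in> elts f' \<longrightarrow> v = v'"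
    have "v = v'" if v: "opair \<beta> v \<in> elts f" and v': "opair \<beta> v' \<in> elts f'" for v v'
    proof (rule extensionality, rule set_eqI)
      fix x
      have "opair \<gamma> w \<in> elts f \<longleftrightarrow> opair \<gamma> w \<in> elts f'" if "\<gamma> \<in> elts \<beta>" for \<gamma> w
      proof -
        have "\<gamma> \<in> elts (succ \<alpha>)" "\<gamma> \<in> elts (succ \<alpha>')"
          using ordinal_mem_succ_trans [OF _ _ that] dom [OF v] dom' [OF v'] \<alpha> \<alpha>' by auto
        then show ?thesis using IH [OF that] ex [of \<gamma>] ex' [of \<gamma>] by metis
      qed
      then show "x \<in> elts v \<longleftrightarrow> x \<in> elts v'"
        unfolding mem_cumulative_iff [OF \<alpha>(2) v] mem_cumulative_iff [OF \<alpha>'(2) v'] by simp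
    qed
    then show "\<forall>v v'. opair \<beta> v \<in> elts f \<longrightarrow> opair \<beta> v' \<in> elts f' \<longrightarrow> v = v'" by simp
  qed
  then show ?thesis using v v' by simp
qed

text \<open>Quantifying over the approximation makes the value a definable functional relation.
  Replacement can then collect the values without any choice of approximations.\<close>

definition cumulative_value :: "'v \<Rightarrow> 'v \<Rightarrow> bool" where
  "cumulative_value \<beta> v \<longleftrightarrow> (\<exists>f. cumulative f \<beta> \<and> opair \<beta> v \<in> elts f)"

lemma definable_cumulative: "fterm t \<Longrightarrow> fterm u \<Longrightarrow> definable (\<lambda>s. cumulative (t s) (u s))"
proof (rule definable_rel)
  show "definable (\<lambda>s. cumulative (s 0) (s 1))"
    unfolding cumulative_def is_fun_def Ex1_def by (rule definable_intros)+
qed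

lemma definable_cumulative_value:
  "fterm t \<Longrightarrow> fterm u \<Longrightarrow> definable (\<lambda>s. cumulative_value (t s) (u s))"
proof (rule definable_rel)
  show "definable (\<lambda>s. cumulative_value (s 0) (s 1))"
    unfolding cumulative_value_def by (rule definable_intros definable_cumulative)+
qed

lemma ex1_cumulative_value:
  assumes "ordinal \<beta>" "\<exists>f. cumulative f \<beta>"
  shows "\<exists>!v. cumulative_value \<beta> v"
proof (rule ex_ex1I)
  show "\<exists>v. cumulative_value \<beta> v"
    using assms(2) opair_app [OF cumulative_is_fun, of _ \<beta> \<beta>] unfolding cumulative_value_def by auto
  show "v = v'" if "cumulative_value \<beta> v" "cumulative_value \<beta> v'" for v v'
    using that cumulative_unique [OF assms(1) _ assms(1)] unfolding cumulative_value_def by meson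
qed

lemma cumulative_exists:
  assumes \<kappa>: "ordinal \<kappa>"
  shows "\<exists>f. cumulative f \<kappa>"
proof (rule minimal_counterexample [of _ \<kappa> "succ \<kappa>"])
  show "definable (\<lambda>s. \<nexists>f. cumulative f (s 0))"
    by (rule definable_intros definable_cumulative)+
  show "\<kappa> \<in> elts (succ \<kappa>)" by simp
next
  fix \<alpha> assume \<alpha>: "\<alpha> \<in> elts (succ \<kappa>)"
    and IH: "\<And>\<beta>. \<beta> \<in> elts \<alpha> \<Longrightarrow> \<beta> \<in> elts (succ \<kappa>) \<Longrightarrow> \<exists>f. cumulative f \<beta>"
  have ord: "ordinal \<alpha>" using \<kappa> \<alpha> ordinal_mem by auto
  have val: "\<exists>!v. cumulative_value \<beta> v" if "\<beta> \<in> elts \<alpha>" for \<beta>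
    using ordinal_mem_succ_trans [OF \<kappa> \<alpha> that]
    by (intro ex1_cumulative_value ordinal_mem [OF ord that] IH [OF that]) simp
  have "\<exists>g. elts g = {p. \<exists>\<beta>\<in>elts \<alpha>. \<exists>v. cumulative_value \<beta> v \<and> p = opair \<beta> v}"
  proof (rule replacement)
    show "definable (\<lambda>s. \<exists>v. cumulative_value (s 0) v \<and> s 1 = opair (s 0) v)"
      by (rule definable_intros definable_cumulative_value)+
    show "\<exists>!p. \<exists>v. cumulative_value \<beta> v \<and> p = opair \<beta> v" if "\<beta> \<in> elts \<alpha>" for \<beta>
      using val [OF that] by (metis)
  qed
  then obtain g where g: "elts g = {p. \<exists>\<beta>\<in>elts \<alpha>. \<exists>v. cumulative_value \<beta> v \<and> p = opair \<beta> v}" ..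
  have "\<exists>W. elts W = {v. \<exists>\<beta>\<in>elts \<alpha>. cumulative_value \<beta> v}"
  proof (rule replacement)
    show "definable (\<lambda>s. cumulative_value (s 0) (s 1))"
      by (rule definable_intros definable_cumulative_value)+
  qed (rule val)
  then obtain W where W: "elts W = {v. \<exists>\<beta>\<in>elts \<alpha>. cumulative_value \<beta> v}" ..
  \<comment> \<open>The next level must be separated from a set: the power set of the union of all
    earlier levels. The bound disappears from its description, since each earlier level is included
    in that union.\<close>
  define U where "U = vset (\<Union>w\<in>elts W. elts w)"
  define v0 where "v0 = vset {x \<in> elts (vset {y. elts y \<subseteq> elts U}). \<exists>w\<in>elts W. elts x \<subseteq> elts w}"
  have "definable (\<lambda>s. \<exists>w\<in>elts W. elts (s 0) \<subseteq> elts w)"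
    by (rule definable_intros)+
  from elts_vset_separation [OF this, of "vset {y. elts y \<subseteq> elts U}"]
  have v0_U: "x \<in> elts v0 \<longleftrightarrow> elts x \<subseteq> elts U \<and> (\<exists>w\<in>elts W. elts x \<subseteq> elts w)" for x
    unfolding v0_def by (simp only: elts_vset_Pow mem_Collect_eq)
  have "elts w \<subseteq> elts U" if "w \<in> elts W" for w
    unfolding U_def elts_vset_Union using that by (rule UN_upper)
  then have "x \<in> elts v0 \<longleftrightarrow> (\<exists>w\<in>elts W. elts x \<subseteq> elts w)" for x
    unfolding v0_U by (meson order_trans)
  then have v0: "x \<in> elts v0 \<longleftrightarrow> (\<exists>\<gamma>\<in>elts \<alpha>. \<exists>w. cumulative_value \<gamma> w \<and> elts x \<subseteq> elts w)" for x
    unfolding W by auto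
  define f where "f = vset (insert (opair \<alpha> v0) (elts g))"
  have elts_f: "elts f = insert (opair \<alpha> v0) (elts g)"
    unfolding f_def by (rule elts_vset_insert)
  \<comment> \<open>Foundation for the singleton of \<open>\<alpha>\<close>. It keeps the new pair
    at \<open>\<alpha>\<close> apart from the pairs of \<open>g\<close>, so that \<open>f\<close> is
    single-valued.\<close>
  have nin: "\<alpha> \<notin> elts \<alpha>"
    using ex_minimal [of "vset {\<alpha>}"] by auto
  have f: "opair \<beta> v \<in> elts f \<longleftrightarrow> \<beta> = \<alpha> \<and> v = v0 \<or> \<beta> \<in> elts \<alpha> \<and> cumulative_value \<beta> v" for \<beta> v
    unfolding elts_f g by auto
  have "is_fun f (succ \<alpha>)"
    unfolding is_fun_def
  proof (intro conjI ballI)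
    fix z assume "z \<in> elts f"
    then show "\<exists>\<beta>\<in>elts (succ \<alpha>). \<exists>v. z = opair \<beta> v"
      unfolding elts_f g by auto
  next
    fix \<beta> assume "\<beta> \<in> elts (succ \<alpha>)"
    then consider "\<beta> = \<alpha>" | "\<beta> \<in> elts \<alpha>" "\<beta> \<noteq> \<alpha>" using nin by auto
    then show "\<exists>!v. opair \<beta> v \<in> elts f"
      unfolding f using val [of \<beta>] nin by cases simp_all
  qed
  moreover have "x \<in> elts v \<longleftrightarrow> (\<exists>\<gamma>\<in>elts \<beta>. \<exists>w. opair \<gamma> w \<in> elts f \<and> elts x \<subseteq> elts w)"
    if \<beta>: "\<beta> \<in> elts (succ \<alpha>)" and v: "opair \<beta> v \<in> elts f" for \<beta> v x
  proof (cases "\<beta> = \<alpha>")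
    case True
    with v nin have "v = v0" by (simp add: f)
    moreover have "opair \<gamma> w \<in> elts f \<longleftrightarrow> cumulative_value \<gamma> w" if "\<gamma> \<in> elts \<alpha>" for \<gamma> w
      using that nin by (auto simp: f)
    ultimately show ?thesis using True v0 by simp
  next
    case False
    with v obtain h where h: "cumulative h \<beta>" "opair \<beta> v \<in> elts h"
      unfolding f cumulative_value_def by auto
    have \<beta>: "\<beta> \<in> elts \<alpha>" using \<beta> False by simp
    \<comment> \<open>\<open>h\<close> witnesses the value at \<open>\<beta>\<close>, but
      \<open>f\<close> was assembled from unrelated witnesses; uniqueness makes \<open>h\<close> and
      \<open>f\<close> agree below \<open>\<beta>\<close>.\<close>
    have "opair \<gamma> w \<in> elts h \<longleftrightarrow> opair \<gamma> w \<in> elts f" if \<gamma>: "\<gamma> \<in> elts \<beta>" for \<gamma> w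
    proof -
      have "\<gamma> \<in> elts \<alpha>" using ordinal_mem_succ_trans [OF ord _ \<gamma>] \<beta> by simp
      then obtain w' where w': "cumulative_value \<gamma> w'" "\<And>u. cumulative_value \<gamma> u \<Longrightarrow> u = w'"
        using val by metis
      then obtain k where k: "cumulative k \<gamma>" "opair \<gamma> w' \<in> elts k"
        unfolding cumulative_value_def by blast
      have "opair \<gamma> (app h \<gamma>) \<in> elts h"
        by (rule opair_app [OF cumulative_is_fun [OF h(1)]]) (simp add: \<gamma>)
      moreover have "u = w'" if "opair \<gamma> u \<in> elts h" for u
        using cumulative_unique [OF ordinal_mem [OF ord \<beta>] h(1)
          ordinal_mem [OF ord \<open>\<gamma> \<in> elts \<alpha>\<close>] k(1) that k(2)] .
      ultimately show ?thesis unfolding f using \<open>\<gamma> \<in> elts \<alpha>\<close> nin w' by metis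
    qed
    then show ?thesis unfolding mem_cumulative_iff [OF h] by simp
  qed
  ultimately have "cumulative f \<alpha>"
    unfolding cumulative_def by (intro conjI ballI allI impI)
  then show "\<exists>f. cumulative f \<alpha>" ..
qed

lemma cumulative_iff:
  assumes "ordinal \<alpha>" "is_fun f (succ \<alpha>)"
  shows "cumulative f \<alpha> \<longleftrightarrow>
    (\<forall>\<beta>\<in>elts (succ \<alpha>). elts (app f \<beta>) = {x. \<exists>\<gamma>\<in>elts \<beta>. elts x \<subseteq> elts (app f \<gamma>)})"
proof -
  have app: "opair \<beta> v \<in> elts f \<longleftrightarrow> v = app f \<beta>" if "\<beta> \<in> elts (succ \<alpha>)" for \<beta> v
    using opair_app [OF assms(2) that] app_equality [OF assms(2)] by metis
  have "opair \<gamma> v \<in> elts f \<longleftrightarrow> v = app f \<gamma>" if "\<beta> \<in> elts (succ \<alpha>)" "\<gamma> \<in> elts \<beta>" for \<beta> \<gamma> v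
    using ordinal_mem_succ_trans [OF assms(1) that] by (intro app) simp
  with app show ?thesis unfolding cumulative_def using assms(2)
    by (simp add: set_eq_iff del: elts_succ cong: ball_cong bex_cong)
qed

text \<open>Later arguments use \<open>cumul \<kappa>\<close> only through such an \<open>f\<close>,
  which contains all the lower levels as well.\<close>

lemma cumul_value:
  assumes "ordinal \<kappa>"
  obtains f where "cumulative f \<kappa>" "opair \<kappa> (cumul \<kappa>) \<in> elts f"
proof -
  obtain f where f: "cumulative f \<kappa>" using cumulative_exists [OF assms] ..
  have eq: "(is_fun g (succ \<kappa>) \<and>
     (\<forall>\<beta>\<in>elts (succ \<kappa>). elts (app g \<beta>) = {x. \<exists>\<gamma>\<in>elts \<beta>. elts x \<subseteq> elts (app g \<gamma>)}) \<and> v = app g \<kappa>)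
     = (cumulative g \<kappa> \<and> v = app g \<kappa>)" (is "(?F \<and> ?L \<and> _) = _") for g v
  proof -
    have "?F \<Longrightarrow> cumulative g \<kappa> \<longleftrightarrow> ?L" by (rule cumulative_iff [OF assms])
    moreover have "cumulative g \<kappa> \<Longrightarrow> ?F" by (rule cumulative_is_fun)
    ultimately show ?thesis by argo
  qed
  have "\<kappa> \<in> elts (succ \<kappa>)" by simp
  note val = opair_app [OF cumulative_is_fun this]
  have "cumul \<kappa> = app f \<kappa>"
    unfolding cumul_def eq
  proof (rule the_equality)
    show "\<exists>g. cumulative g \<kappa> \<and> app f \<kappa> = app g \<kappa>" using f by blast
    show "v = app f \<kappa>" if v: "\<exists>g. cumulative g \<kappa> \<and> v = app g \<kappa>" for v
    proof -
      from v obtain g where g: "cumulative g \<kappa>" "v = app g \<kappa>" by blast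
      show ?thesis
        unfolding g(2) by (rule cumulative_unique [OF assms g(1) assms f val [OF g(1)] val [OF f]])
    qed
  qed
  then show thesis using val [OF f] by (intro that [OF f]) (simp only:)
qed

end

section \<open>Embeddings fix the levels below the critical point\<close>

abbreviation Impl :: "fm \<Rightarrow> fm \<Rightarrow> fm" where
  "Impl \<phi> \<psi> \<equiv> Neg (Conj \<phi> (Neg \<psi>))"

abbreviation Exis :: "nat \<Rightarrow> fm \<Rightarrow> fm" where
  "Exis a \<phi> \<equiv> Neg (Univ a (Neg \<phi>))"

definition Pair_fm :: "nat \<Rightarrow> nat \<Rightarrow> nat \<Rightarrow> fm" where
  "Pair_fm p a b = Univ 5 (Conj (Impl (Memb 5 p) (Impl (Neg (Equal 5 a)) (Equal 5 b)))
     (Conj (Impl (Equal 5 a) (Memb 5 p)) (Impl (Equal 5 b) (Memb 5 p))))"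

definition Opair_fm :: fm where
  "Opair_fm = Exis 3 (Exis 4 (Conj (Pair_fm 3 1 1) (Conj (Pair_fm 4 1 2) (Pair_fm 0 3 4))))"

text \<open>Variables 6, 7 and 8 stand for a level, its index and the function listing the levels.
  This is the half of the recursion that bounds a level from above: each of its elements is included
  in a level of smaller index.\<close>

definition Value_cover :: fm where
  "Value_cover = Univ 9 (Impl (Memb 9 6) (Exis 1 (Exis 2 (Exis 0
     (Conj (Memb 1 7) (Conj (Memb 0 8) (Conj Opair_fm (Univ 10 (Impl (Memb 10 9) (Memb 10 2))))))))))"

text \<open>Variable 8 is the listing function, variable 1 an argument, and variable 11 the only
  value that the function may have there.\<close>

definition Value_unique :: fm where
  "Value_unique = Univ 2 (Univ 0 (Impl (Conj (Memb 0 8) Opair_fm) (Equal 2 11)))"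

lemma pure_formulas: "pure Opair_fm" "pure Value_cover" "pure Value_unique"
  by (simp_all add: Opair_fm_def Pair_fm_def Value_cover_def Value_unique_def)

text \<open>The transferred formulas are evaluated in \<open>M\<close>, so pairs are relativised to
  a class \<open>D\<close>. Both formulas use the same relativised notion, and hence pairs in the
  sense of \<open>M\<close> are never compared with \<open>opair\<close>.\<close>

definition rel_pair :: "('v \<Rightarrow> 'v \<Rightarrow> bool) \<Rightarrow> 'v set \<Rightarrow> 'v \<Rightarrow> 'v \<Rightarrow> 'v \<Rightarrow> bool" where
  "rel_pair mem D p a b \<longleftrightarrow> (\<forall>u\<in>D. mem u p \<longleftrightarrow> u = a \<or> u = b)"

definition rel_opair :: "('v \<Rightarrow> 'v \<Rightarrow> bool) \<Rightarrow> 'v set \<Rightarrow> 'v \<Rightarrow> 'v \<Rightarrow> 'v \<Rightarrow> bool" where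
  "rel_opair mem D p a b \<longleftrightarrow>
     (\<exists>y\<in>D. \<exists>z\<in>D. rel_pair mem D y a a \<and> rel_pair mem D z a b \<and> rel_pair mem D p y z)"

lemma sat_Pair_fm:
  "p \<noteq> 5 \<Longrightarrow> a \<noteq> 5 \<Longrightarrow> b \<noteq> 5 \<Longrightarrow>
    sat mem j M D (Pair_fm p a b) s \<longleftrightarrow> rel_pair mem D (s p) (s a) (s b)"
  by (auto simp: Pair_fm_def rel_pair_def)

lemma sat_Opair_fm: "sat mem j M D Opair_fm s \<longleftrightarrow> rel_opair mem D (s 0) (s 1) (s 2)"
  by (simp add: Opair_fm_def rel_opair_def sat_Pair_fm)

lemma sat_Value_cover:
  "sat mem j M D Value_cover s \<longleftrightarrow>
    (\<forall>x\<in>D. mem x (s 6) \<longrightarrow> (\<exists>\<delta>\<in>D. \<exists>w\<in>D. \<exists>p\<in>D. mem \<delta> (s 7) \<and> mem p (s 8) \<and>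
       rel_opair mem D p \<delta> w \<and> (\<forall>u\<in>D. mem u x \<longrightarrow> mem u w)))"
  by (simp add: Value_cover_def sat_Opair_fm)

lemma sat_Value_unique:
  "sat mem j M D Value_unique s \<longleftrightarrow>
    (\<forall>w\<in>D. \<forall>p\<in>D. mem p (s 8) \<and> rel_opair mem D p (s 1) w \<longrightarrow> w = s 11)"
  by (auto simp: Value_unique_def sat_Opair_fm)

context zf_model
begin

lemma rel_pair_iff: "rel_pair mem UNIV p a b \<longleftrightarrow> p = vset {a, b}"
proof
  assume "rel_pair mem UNIV p a b"
  then have "elts p = {a, b}" unfolding rel_pair_def elts_def by auto
  then show "p = vset {a, b}" by (simp add: vset_eqI)
next
  assume "p = vset {a, b}"
  then have "elts p = {a, b}" by simp
  then show "rel_pair mem UNIV p a b" unfolding rel_pair_def elts_def by auto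
qed

lemma rel_opair_iff: "rel_opair mem UNIV p a b \<longleftrightarrow> p = opair a b"
  unfolding rel_opair_def rel_pair_iff opair_def by simp

context
  assumes emb: "elementary_embedding j M"
begin

lemma elementary: "pure \<phi> \<Longrightarrow> sat mem j M UNIV \<phi> s \<longleftrightarrow> sat mem j M M \<phi> (j \<circ> s)"
  using emb unfolding elementary_embedding_def by simp

lemma j_in_M: "j x \<in> M"
  using emb unfolding elementary_embedding_def by auto

lemma M_transitive: "x \<in> M \<Longrightarrow> y \<in> elts x \<Longrightarrow> y \<in> M"
  using emb unfolding elementary_embedding_def by auto

lemma j_mem: "j x \<in> elts (j y) \<longleftrightarrow> x \<in> elts y"
  using elementary [of "Memb 0 1" "\<lambda>n. if n = 0 then x else y"] by (simp add: elts_def)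

lemma j_subset:
  assumes "elts x \<subseteq> elts y"
  shows "elts (j x) \<subseteq> elts (j y)"
proof -
  have "sat mem j M M (Univ 0 (Impl (Memb 0 1) (Memb 0 2))) (j \<circ> (\<lambda>n. if n = 1 then x else y))"
    using assms by (subst elementary [symmetric]) (auto simp: elts_def)
  then show ?thesis using M_transitive [OF j_in_M] by (auto simp: elts_def)
qed

text \<open>In \<open>M\<close>, an element of \<open>j v\<close> is included in a value of
  \<open>j f\<close> at some \<open>\<delta>\<close> in \<open>\<beta>\<close>. As \<open>j\<close>
  fixes \<open>\<delta>\<close> and the value \<open>c\<close> of \<open>f\<close> there, uniqueness
  transferred to \<open>M\<close> identifies the value of \<open>j f\<close> with \<open>c\<close>,
  and subsets of \<open>c\<close> belong to \<open>v\<close>.\<close>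

lemma j_value_subset:
  assumes \<alpha>: "ordinal \<alpha>" "cumulative f \<alpha>" and v: "opair \<beta> v \<in> elts f" and \<beta>: "j \<beta> = \<beta>"
    and below: "\<And>\<delta> w. \<delta> \<in> elts \<beta> \<Longrightarrow> opair \<delta> w \<in> elts f \<Longrightarrow> j \<delta> = \<delta> \<and> j w = w"
  shows "elts (j v) \<subseteq> elts v"
proof
  fix x assume x: "x \<in> elts (j v)"
  then have "x \<in> M" using M_transitive j_in_M by blast
  \<comment> \<open>The default value \<open>\<beta>\<close> serves variable 7.\<close>
  define s where "s = (\<lambda>n::nat. \<beta>)(6 := v, 8 := f)"
  have "sat mem j M UNIV Value_cover s"
    unfolding sat_Value_cover rel_opair_iff
    using mem_cumulative_iff [OF \<alpha>(2) v] by (simp add: s_def elts_def subset_eq)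
  then have "sat mem j M M Value_cover (j \<circ> s)"
    using elementary pure_formulas by blast
  then obtain \<delta> w p where w: "\<delta> \<in> elts \<beta>" "w \<in> M" "p \<in> M" "mem p (j f)" "rel_opair mem M p \<delta> w"
      "\<And>u. u \<in> M \<Longrightarrow> mem u x \<Longrightarrow> mem u w"
    using x \<open>x \<in> M\<close> unfolding sat_Value_cover by (auto simp: s_def elts_def \<beta>)
  have \<delta>: "\<delta> \<in> elts (succ \<alpha>)"
    using ordinal_mem_succ_trans [OF \<alpha>(1) is_fun_domain [OF cumulative_is_fun [OF \<alpha>(2)] v] w(1)] by simp
  define c where "c = app f \<delta>"
  have c: "opair \<delta> c \<in> elts f"
    unfolding c_def by (rule opair_app [OF cumulative_is_fun [OF \<alpha>(2)] \<delta>])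
  \<comment> \<open>The default value \<open>\<delta>\<close> serves variable 1.\<close>
  define t where "t = (\<lambda>n::nat. \<delta>)(11 := c, 8 := f)"
  have "sat mem j M UNIV Value_unique t"
    unfolding sat_Value_unique rel_opair_iff
    using app_equality [OF cumulative_is_fun [OF \<alpha>(2)]] by (auto simp: t_def elts_def c_def)
  then have "sat mem j M M Value_unique (j \<circ> t)"
    using elementary pure_formulas by blast
  moreover have "j \<delta> = \<delta>" "j c = c" using below [OF w(1) c] by auto
  ultimately have "w = c"
    using w unfolding sat_Value_unique by (auto simp: t_def)
  \<comment> \<open>The inclusion was obtained only for elements of \<open>M\<close>; transitivity
    of \<open>M\<close> makes it a genuine one.\<close>
  have "elts x \<subseteq> elts c"
    using w(6) M_transitive [OF \<open>x \<in> M\<close>] unfolding \<open>w = c\<close> elts_def by auto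
  then show "x \<in> elts v"
    unfolding mem_cumulative_iff [OF \<alpha>(2) v] using w(1) c by blast
qed

text \<open>Two claims are carried through one induction. A level \<open>w\<close> below
  \<open>\<kappa>\<close> is fixed as a set, so \<open>j x\<close> stays inside \<open>w\<close>
  whenever \<open>x\<close> does; the elements of \<open>w\<close> are fixed, so \<open>j x\<close>
  and \<open>x\<close> then agree. The first claim is restricted to indices below
  \<open>\<kappa>\<close>, where \<open>j\<close> fixes the index.\<close>

lemma fixed_if_in_cumul:
  assumes \<kappa>: "critical_point j \<kappa>" and x: "x \<in> elts (cumul \<kappa>)"
  shows "j x = x"
proof -
  have ord: "ordinal \<kappa>" and j_below: "\<And>\<alpha>. \<alpha> \<in> elts \<kappa> \<Longrightarrow> j \<alpha> = \<alpha>"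
    using \<kappa> unfolding critical_point_def by auto
  obtain f where f: "cumulative f \<kappa>" "opair \<kappa> (cumul \<kappa>) \<in> elts f"
    using cumul_value [OF ord] .
  have "\<forall>v. opair \<kappa> v \<in> elts f \<longrightarrow> (\<forall>x\<in>elts v. j x = x) \<and> (\<kappa> \<in> elts \<kappa> \<longrightarrow> j v = v)"
  proof (rule minimal_counterexample [of "\<lambda>\<beta>. \<forall>v. opair \<beta> v \<in> elts f \<longrightarrow>
      (\<forall>x\<in>elts v. j x = x) \<and> (\<beta> \<in> elts \<kappa> \<longrightarrow> j v = v)" \<kappa> "succ \<kappa>"])
    show "definable (\<lambda>s. \<not> (\<forall>v. opair (s 0) v \<in> elts f \<longrightarrow>
        (\<forall>x\<in>elts v. j x = x) \<and> (s 0 \<in> elts \<kappa> \<longrightarrow> j v = v)))"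
      by (rule definable_intros)+
    show "\<kappa> \<in> elts (succ \<kappa>)" by simp
  next
    fix \<beta> assume \<beta>: "\<beta> \<in> elts (succ \<kappa>)"
      and IH: "\<And>\<gamma>. \<gamma> \<in> elts \<beta> \<Longrightarrow> \<gamma> \<in> elts (succ \<kappa>) \<Longrightarrow>
        \<forall>v. opair \<gamma> v \<in> elts f \<longrightarrow> (\<forall>x\<in>elts v. j x = x) \<and> (\<gamma> \<in> elts \<kappa> \<longrightarrow> j v = v)"
    have below: "\<gamma> \<in> elts \<kappa>" if "\<gamma> \<in> elts \<beta>" for \<gamma>
      by (rule ordinal_mem_succ_trans [OF ord \<beta> that])
    have IH1: "j w = w" and IH2: "\<And>x. x \<in> elts w \<Longrightarrow> j x = x"
      if "\<gamma> \<in> elts \<beta>" "opair \<gamma> w \<in> elts f" for \<gamma> w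
      using IH [OF that(1)] below [OF that(1)] that(2) by auto
    show "\<forall>v. opair \<beta> v \<in> elts f \<longrightarrow> (\<forall>x\<in>elts v. j x = x) \<and> (\<beta> \<in> elts \<kappa> \<longrightarrow> j v = v)"
    proof (intro allI impI)
      fix v assume v: "opair \<beta> v \<in> elts f"
      have fixed: "j x = x" if x: "x \<in> elts v" for x
      proof -
        obtain \<gamma> w where w: "\<gamma> \<in> elts \<beta>" "opair \<gamma> w \<in> elts f" "elts x \<subseteq> elts w"
          using x unfolding mem_cumulative_iff [OF f(1) v] by blast
        have "elts (j x) \<subseteq> elts w" using j_subset [OF w(3)] IH1 [OF w(1,2)] by simp
        then have "y \<in> elts (j x) \<longleftrightarrow> y \<in> elts x" for y
          using IH2 [OF w(1,2)] j_mem [of y x] w(3) by (metis subsetD)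
        then show ?thesis by (intro extensionality) blast
      qed
      moreover have "j v = v" if \<beta>: "\<beta> \<in> elts \<kappa>"
      proof (rule extensionality, rule equalityI)
        show "elts (j v) \<subseteq> elts v"
          using IH1 below j_below
          by (intro j_value_subset [OF ord f(1) v j_below [OF \<beta>]]) blast
        show "elts v \<subseteq> elts (j v)" using fixed j_mem by (metis subsetI)
      qed
      ultimately show "(\<forall>x\<in>elts v. j x = x) \<and> (\<beta> \<in> elts \<kappa> \<longrightarrow> j v = v)" by simp
    qed
  qed
  then show ?thesis using f(2) x by blast
qed

end

section \<open>Transitivity of the levels, and products\<close>

text \<open>An element of a lower level is included in a still lower one, whose index is again below
  \<open>\<kappa>\<close>. This passes from the system to its conditions, automorphisms and
  groups.\<close>

lemma cumul_transitive:
  assumes "ordinal \<kappa>" "x \<in> elts (cumul \<kappa>)" "y \<in> elts x"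
  shows "y \<in> elts (cumul \<kappa>)"
proof -
  obtain f where f: "cumulative f \<kappa>" "opair \<kappa> (cumul \<kappa>) \<in> elts f"
    using cumul_value [OF assms(1)] .
  obtain \<gamma> w where w: "\<gamma> \<in> elts \<kappa>" "opair \<gamma> w \<in> elts f" "elts x \<subseteq> elts w"
    using assms(2) unfolding mem_cumulative_iff [OF f] by blast
  then have "y \<in> elts w" using assms(3) by blast
  then obtain \<delta> u where "\<delta> \<in> elts \<gamma>" "opair \<delta> u \<in> elts f" "elts y \<subseteq> elts u"
    unfolding mem_cumulative_iff [OF f(1) w(2)] by blast
  moreover have "\<delta> \<in> elts \<kappa>"
    using ordinal_mem_succ_trans [OF assms(1) _ \<open>\<delta> \<in> elts \<gamma>\<close>] w(1) by simp
  ultimately show ?thesis unfolding mem_cumulative_iff [OF f] by blast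
qed

lemma opair_in_cumul:
  assumes "ordinal \<kappa>" "opair a b \<in> elts (cumul \<kappa>)"
  shows "a \<in> elts (cumul \<kappa>)" "b \<in> elts (cumul \<kappa>)"
proof -
  have "vset {a, b} \<in> elts (cumul \<kappa>)"
    using cumul_transitive [OF assms] unfolding opair_def by simp
  from cumul_transitive [OF assms(1) this]
  show "a \<in> elts (cumul \<kappa>)" "b \<in> elts (cumul \<kappa>)" by simp_all
qed


lemma mem_vset_Pow [simp]: "z \<in> elts (vset {y. elts y \<subseteq> elts x}) \<longleftrightarrow> elts z \<subseteq> elts x"
  unfolding elts_vset_Pow by simp

lemma mem_vset_Union: "z \<in> elts (vset (\<Union>y\<in>elts x. elts y)) \<longleftrightarrow> (\<exists>y\<in>elts x. z \<in> elts y)"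
  unfolding elts_vset_Union by simp

text \<open>Kuratowski pairs lie in the double power set of the union, from which the product is
  separated.\<close>

lemma elts_vset_product:
  "elts (vset {opair a b |a b. a \<in> elts x \<and> b \<in> elts y}) = {opair a b |a b. a \<in> elts x \<and> b \<in> elts y}"
proof (rule elts_vset)
  define U where "U = vset (elts x \<union> elts y)"
  define S where "S = vset {z. elts z \<subseteq> elts (vset {z. elts z \<subseteq> elts U})}"
  have U: "elts U = elts x \<union> elts y" unfolding U_def by (rule elts_vset_Un)
  have S: "z \<in> elts S \<longleftrightarrow> (\<forall>w\<in>elts z. elts w \<subseteq> elts U)" for z
    unfolding S_def by (simp only: mem_vset_Pow subset_eq [of "elts z"])
  have "opair a b \<in> elts S" if "a \<in> elts x" "b \<in> elts y" for a b
    using that unfolding S opair_def by (auto simp: U)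
  then have eq: "{opair a b |a b. a \<in> elts x \<and> b \<in> elts y} =
      {z \<in> elts S. \<exists>a\<in>elts x. \<exists>b\<in>elts y. z = opair a b}"
    by auto
  have "definable (\<lambda>s. \<exists>a\<in>elts x. \<exists>b\<in>elts y. s 0 = opair a b)"
    by (rule definable_intros)+
  then show "\<exists>z. elts z = {opair a b |a b. a \<in> elts x \<and> b \<in> elts y}"
    unfolding eq by (intro exI) (rule elts_vset_separation)
qed

lemma mem_vset_product:
  "opair a b \<in> elts (vset {opair a b |a b. a \<in> elts x \<and> b \<in> elts y}) \<longleftrightarrow> a \<in> elts x \<and> b \<in> elts y"
  unfolding elts_vset_product by auto

end

section \<open>The preorder of conditions\<close>

locale forcing_model = forcing_structure mem P le one + zf_model mem j M
  for mem :: "'v \<Rightarrow> 'v \<Rightarrow> bool" and P le one :: 'v and j :: "'v \<Rightarrow> 'v" and M :: "'v set" +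
  assumes forcing: forcing_notion
begin

lemma leq_dom: "leq q p \<Longrightarrow> q \<in> elts P" "leq q p \<Longrightarrow> p \<in> elts P"
  using forcing unfolding forcing_notion_def leq_def by fastforce+

lemma leq_refl: "p \<in> elts P \<Longrightarrow> leq p p"
  using forcing unfolding forcing_notion_def by blast

lemma leq_trans [trans]: "leq p q \<Longrightarrow> leq q r \<Longrightarrow> leq p r"
  using forcing leq_dom unfolding forcing_notion_def by metis

lemma one_in_P: "one \<in> elts P"
  using forcing unfolding forcing_notion_def by blast

lemma leq_one: "p \<in> elts P \<Longrightarrow> leq p one"
  using forcing unfolding forcing_notion_def by blast

lemma definable_leq [definable_intros]:
  "fterm t \<Longrightarrow> fterm u \<Longrightarrow> definable (\<lambda>s. leq (t s) (u s))"
  unfolding leq_def by (intro definable_elts fterm_opair fterm_const)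

section \<open>Forced equality\<close>

lemma subname_closedD: "subname_closed t \<Longrightarrow> x \<in> elts t \<Longrightarrow> opair p w \<in> elts x \<Longrightarrow> w \<in> elts t"
  unfolding subname_closed_def by blast

text \<open>Foundation descends along membership, but a subname lies three steps down:
  \<open>z\<close> is in \<open>vset {p, z}\<close>, which is in \<open>opair p z\<close>, which is
  in the name. So \<open>t\<close> is enlarged by its pairs (\<open>t1\<close>) and their elements
  (\<open>t2\<close>), and a set there counts as bad when a bad name lies the right number of steps
  below it. Then no bad set is minimal.\<close>

lemma subname_induct:
  assumes A: "definable (\<lambda>s. \<not> A (s 0))" and x: "x \<in> elts t"
    and step: "\<And>y. y \<in> elts t \<Longrightarrow> (\<And>p z. opair p z \<in> elts y \<Longrightarrow> z \<in> elts t \<Longrightarrow> A z) \<Longrightarrow> A y"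
  shows "A x"
proof (rule ccontr)
  assume "\<not> A x"
  define t1 where "t1 = vset (\<Union>y\<in>elts t. elts y)"
  define t2 where "t2 = vset (\<Union>y\<in>elts t1. elts y)"
  define X where "X = vset (elts t \<union> elts (vset (elts t1 \<union> elts t2)))"
  have t1: "b \<in> elts t1 \<longleftrightarrow> (\<exists>y\<in>elts t. b \<in> elts y)" and t2: "b \<in> elts t2 \<longleftrightarrow> (\<exists>y\<in>elts t1. b \<in> elts y)" for b
    unfolding t1_def t2_def by (simp_all only: mem_vset_Union)
  have X: "elts X = elts t \<union> elts t1 \<union> elts t2"
    unfolding X_def by (rule trans [OF elts_vset_Un]) (simp only: elts_vset_Un Un_assoc)
  define bad where "bad b \<longleftrightarrow> b \<in> elts t \<and> \<not> A b" for b
  have def_bad: "fterm u \<Longrightarrow> definable (\<lambda>s. bad (u s))" for u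
    unfolding bad_def using definable_rel [of "\<lambda>x y. \<not> A x" u u, OF A]
    by (intro definable_conj definable_elts fterm_const) simp_all
  have "\<not> (bad x \<or> x \<in> elts t1 \<and> (\<exists>d\<in>elts x. \<exists>c\<in>elts d. bad c) \<or> x \<in> elts t2 \<and> (\<exists>c\<in>elts x. bad c))"
  proof (rule minimal_counterexample [of "\<lambda>b. \<not> (bad b \<or> b \<in> elts t1 \<and> (\<exists>d\<in>elts b. \<exists>c\<in>elts d. bad c)
      \<or> b \<in> elts t2 \<and> (\<exists>c\<in>elts b. bad c))" x X])
    show "definable (\<lambda>s. \<not> \<not> (bad (s 0) \<or> s 0 \<in> elts t1 \<and> (\<exists>d\<in>elts (s 0). \<exists>c\<in>elts d. bad c)
        \<or> s 0 \<in> elts t2 \<and> (\<exists>c\<in>elts (s 0). bad c)))"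
      by (rule definable_intros def_bad)+
    show "x \<in> elts X" using x X by simp
  next
    fix b assume min: "\<And>c. c \<in> elts b \<Longrightarrow> c \<in> elts X \<Longrightarrow>
      \<not> (bad c \<or> c \<in> elts t1 \<and> (\<exists>d\<in>elts c. \<exists>c\<in>elts d. bad c) \<or> c \<in> elts t2 \<and> (\<exists>c\<in>elts c. bad c))"
    have "\<not> bad b"
    proof
      assume "bad b"
      then obtain p z where z: "opair p z \<in> elts b" "bad z"
        using step [of b] unfolding bad_def by blast
      moreover have "opair p z \<in> elts t1"
        using z(1) \<open>bad b\<close> unfolding t1 bad_def by blast
      moreover have "\<exists>d\<in>elts (opair p z). z \<in> elts d"
        unfolding opair_def by simp
      ultimately show False using min [of "opair p z"] unfolding X by blast
    qed
    moreover have False if "b \<in> elts t1" "d \<in> elts b" "c \<in> elts d" "bad c" for c d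
    proof -
      have "d \<in> elts t2" using that(1,2) t2 by blast
      then show ?thesis using min [of d] that(2-4) unfolding X by blast
    qed
    moreover have False if "c \<in> elts b" "bad c" for c
      using min [of c] that unfolding X bad_def by blast
    ultimately show "\<not> (bad b \<or> b \<in> elts t1 \<and> (\<exists>d\<in>elts b. \<exists>c\<in>elts d. bad c)
      \<or> b \<in> elts t2 \<and> (\<exists>c\<in>elts b. bad c))" by blast
  qed
  then show False using x \<open>\<not> A x\<close> unfolding bad_def by simp
qed

definition eq_relation :: "'v \<Rightarrow> 'v \<Rightarrow> bool" where
  "eq_relation t R \<longleftrightarrow> (\<forall>q\<in>elts P. \<forall>u\<in>elts t. \<forall>v\<in>elts t.
     opair q (opair u v) \<in> elts R \<longleftrightarrow> eq_half R q u v \<and> eq_half R q v u)"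

lemma eq_relationD:
  "eq_relation t R \<Longrightarrow> q \<in> elts P \<Longrightarrow> u \<in> elts t \<Longrightarrow> v \<in> elts t \<Longrightarrow>
    opair q (opair u v) \<in> elts R \<longleftrightarrow> eq_half R q u v \<and> eq_half R q v u"
  unfolding eq_relation_def by blast

lemma eq_relation_sym:
  assumes "eq_relation t R" "q \<in> elts P" "u \<in> elts t" "v \<in> elts t"
  shows "opair q (opair u v) \<in> elts R \<longleftrightarrow> opair q (opair v u) \<in> elts R"
  using eq_relationD [OF assms] eq_relationD [OF assms(1,2,4,3)] by blast

lemma eq_half_mono: "eq_half X p u v \<Longrightarrow> elts X \<subseteq> elts R \<Longrightarrow> eq_half R p u v"
  unfolding eq_half_def by blast

lemma eq_half_leq: "eq_half R p u v \<Longrightarrow> leq q p \<Longrightarrow> eq_half R q u v"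
  unfolding eq_half_def using leq_trans by blast

lemma eq_halfE:
  assumes "eq_half R p u v" "opair s z \<in> elts u" "leq q p" "leq q s"
  obtains r s' w where "leq r q" "opair s' w \<in> elts v" "leq r s'" "opair r (opair z w) \<in> elts R"
  using assms unfolding eq_half_def by blast

text \<open>The recursion for forced equality is monotone, so it has a greatest fixed point;
  no recursion on names is needed.\<close>

lemma eq_relation_exists: "\<exists>R. eq_relation t R"
proof -
  define T where "T = vset {opair q z |q z. q \<in> elts P \<and> z \<in> elts (vset {opair u v |u v. u \<in> elts t \<and> v \<in> elts t})}"
  have T: "opair q (opair u v) \<in> elts T" if "q \<in> elts P" "u \<in> elts t" "v \<in> elts t" for q u v
    using that unfolding T_def by (simp only: mem_vset_product)
  define postfixed where "postfixed X \<longleftrightarrow> elts X \<subseteq> elts T \<and>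
    (\<forall>q u v. opair q (opair u v) \<in> elts X \<longrightarrow> eq_half X q u v \<and> eq_half X q v u)" for X
  \<comment> \<open>The union of all postfixed sets, as in the Knaster-Tarski theorem. The bound
    \<open>T\<close> keeps it a set.\<close>
  define R where "R = vset {z \<in> elts T. \<exists>X. postfixed X \<and> z \<in> elts X}"
  have "definable (\<lambda>s. \<exists>X. postfixed X \<and> s 0 \<in> elts X)"
    unfolding postfixed_def eq_half_def by (rule definable_intros)+
  from elts_vset_separation [OF this, of T]
  have R: "z \<in> elts R \<longleftrightarrow> (\<exists>X. postfixed X \<and> z \<in> elts X)" for z
    unfolding R_def by (auto simp: postfixed_def)
  have "postfixed R"
    unfolding postfixed_def
  proof (intro conjI allI impI)
    show "elts R \<subseteq> elts T" using R unfolding postfixed_def by blast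
  next
    fix q u v assume "opair q (opair u v) \<in> elts R"
    then obtain X where X: "postfixed X" "opair q (opair u v) \<in> elts X" unfolding R by blast
    have "elts X \<subseteq> elts R" using R X(1) by blast
    then show "eq_half R q u v" "eq_half R q v u"
      using X eq_half_mono unfolding postfixed_def by blast+
  qed
  have "eq_relation t R"
    unfolding eq_relation_def
  proof (intro ballI iffI)
    fix q u v assume "opair q (opair u v) \<in> elts R"
    then show "eq_half R q u v \<and> eq_half R q v u"
      using \<open>postfixed R\<close> unfolding postfixed_def by blast
  next
    fix q u v assume q: "q \<in> elts P" "u \<in> elts t" "v \<in> elts t" "eq_half R q u v \<and> eq_half R q v u"
    \<comment> \<open>For the converse clause: the enlarged set is still postfixed by monotonicity,
      hence included in \<open>R\<close>.\<close>
    define X where "X = vset (insert (opair q (opair u v)) (elts R))"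
    have X: "elts X = insert (opair q (opair u v)) (elts R)"
      unfolding X_def by (rule elts_vset_insert)
    have RX: "elts R \<subseteq> elts X" using X by blast
    have "postfixed X"
      unfolding postfixed_def
    proof (intro conjI allI impI)
      have "elts R \<subseteq> elts T" using \<open>postfixed R\<close> unfolding postfixed_def by (rule conjunct1)
      then show "elts X \<subseteq> elts T" using T [OF q(1-3)] unfolding X by simp
    next
      fix q' u' v' assume "opair q' (opair u' v') \<in> elts X"
      then have "eq_half R q' u' v' \<and> eq_half R q' v' u'"
        using q \<open>postfixed R\<close> unfolding X postfixed_def by auto
      then show "eq_half X q' u' v'" "eq_half X q' v' u'"
        using eq_half_mono RX by blast+
    qed
    then show "opair q (opair u v) \<in> elts R" using X R by blast
  qed
  then show ?thesis ..
qed

text \<open>The induction is on \<open>u\<close> alone, with \<open>v\<close> arbitrary. The second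
  half of the recursion exchanges the two names; symmetry of the relation turns it round, so that
  the hypothesis for subnames of \<open>u\<close> applies again.\<close>

lemma eq_relation_unique:
  assumes t: "subname_closed t" "eq_relation t R" and t': "subname_closed t'" "eq_relation t' R'"
    and u: "u \<in> elts t" "u \<in> elts t'" and v: "v \<in> elts t" "v \<in> elts t'" and p: "p \<in> elts P"
  shows "opair p (opair u v) \<in> elts R \<longleftrightarrow> opair p (opair u v) \<in> elts R'"
proof -
  have "u \<in> elts t' \<longrightarrow> (\<forall>v. v \<in> elts t \<and> v \<in> elts t' \<longrightarrow> (\<forall>p\<in>elts P.
      opair p (opair u v) \<in> elts R \<longleftrightarrow> opair p (opair u v) \<in> elts R'))"
  proof (rule subname_induct [of "\<lambda>u. u \<in> elts t' \<longrightarrow> (\<forall>v. v \<in> elts t \<and> v \<in> elts t' \<longrightarrow> (\<forall>p\<in>elts P.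
      opair p (opair u v) \<in> elts R \<longleftrightarrow> opair p (opair u v) \<in> elts R'))" u t, OF _ u(1)])
    show "definable (\<lambda>s. \<not> (s 0 \<in> elts t' \<longrightarrow> (\<forall>v. v \<in> elts t \<and> v \<in> elts t' \<longrightarrow> (\<forall>p\<in>elts P.
        opair p (opair (s 0) v) \<in> elts R \<longleftrightarrow> opair p (opair (s 0) v) \<in> elts R'))))"
      by (rule definable_intros)+
  next
    fix u assume u: "u \<in> elts t" and IH: "\<And>s z. opair s z \<in> elts u \<Longrightarrow> z \<in> elts t \<Longrightarrow>
      z \<in> elts t' \<longrightarrow> (\<forall>v. v \<in> elts t \<and> v \<in> elts t' \<longrightarrow> (\<forall>p\<in>elts P.
        opair p (opair z v) \<in> elts R \<longleftrightarrow> opair p (opair z v) \<in> elts R'))"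
    show "u \<in> elts t' \<longrightarrow> (\<forall>v. v \<in> elts t \<and> v \<in> elts t' \<longrightarrow> (\<forall>p\<in>elts P.
        opair p (opair u v) \<in> elts R \<longleftrightarrow> opair p (opair u v) \<in> elts R'))"
    proof (intro impI allI ballI, elim conjE)
      fix v p assume u': "u \<in> elts t'" and v: "v \<in> elts t" and v': "v \<in> elts t'" and p: "p \<in> elts P"
      have sub: "opair r (opair z w) \<in> elts R \<longleftrightarrow> opair r (opair z w) \<in> elts R'"
        and sub': "opair r (opair w z) \<in> elts R \<longleftrightarrow> opair r (opair w z) \<in> elts R'"
        if "opair s z \<in> elts u" "opair s' w \<in> elts v" "r \<in> elts P" for r s s' z w
      proof -
        have z: "z \<in> elts t" "z \<in> elts t'" and w: "w \<in> elts t" "w \<in> elts t'"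
          using subname_closedD t(1) t'(1) u u' v v' that by blast+
        show "opair r (opair z w) \<in> elts R \<longleftrightarrow> opair r (opair z w) \<in> elts R'"
          using IH [OF that(1) z(1)] z w that(3) by blast
        then show "opair r (opair w z) \<in> elts R \<longleftrightarrow> opair r (opair w z) \<in> elts R'"
          using eq_relation_sym [OF t(2) that(3) z(1) w(1)] eq_relation_sym [OF t'(2) that(3) z(2) w(2)]
          by blast
      qed
      have "eq_half R p u v \<longleftrightarrow> eq_half R' p u v"
        unfolding eq_half_def using sub leq_dom(1) by blast
      moreover have "eq_half R p v u \<longleftrightarrow> eq_half R' p v u"
        unfolding eq_half_def using sub' leq_dom(1) by blast
      ultimately show "opair p (opair u v) \<in> elts R \<longleftrightarrow> opair p (opair u v) \<in> elts R'"
        using eq_relationD [OF t(2) p u v] eq_relationD [OF t'(2) p u' v'] by blast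
    qed
  qed
  then show ?thesis using u v p by blast
qed

text \<open>By uniqueness, \<open>feq\<close> can be read off from any approximation. The laws of
  forced equality can thus be checked for one relation \<open>R\<close> on a set that contains all
  the names concerned.\<close>

lemma feq_iff:
  assumes t: "subname_closed t" "eq_relation t R" and x: "x \<in> elts t" "y \<in> elts t" and p: "p \<in> elts P"
  shows "feq x y p \<longleftrightarrow> opair p (opair x y) \<in> elts R"
proof
  assume "feq x y p"
  then obtain t' R' where t': "x \<in> elts t'" "y \<in> elts t'" "subname_closed t'" "eq_relation t' R'"
      "opair p (opair x y) \<in> elts R'"
    unfolding feq_def eq_relation_def by blast
  then show "opair p (opair x y) \<in> elts R"
    using eq_relation_unique [OF t t'(3,4) x(1) t'(1) x(2) t'(2) p] by blast
next
  assume "opair p (opair x y) \<in> elts R"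
  then show "feq x y p"
    using t x unfolding feq_def eq_relation_def by blast
qed

text \<open>The recursion for equality inspects only pairs, and only inside a set closed under
  subnames. This class, which includes \<open>names\<close>, is therefore its natural
  domain.\<close>

definition namelike :: "'v set" where
  "namelike = {x. \<exists>t. x \<in> elts t \<and> subname_closed t}"

lemma subname_closed_Un:
  "subname_closed t \<Longrightarrow> subname_closed t' \<Longrightarrow> subname_closed (vset (elts t \<union> elts t'))"
  unfolding subname_closed_def elts_vset_Un by blast

lemma subname_closed_insert:
  "subname_closed t \<Longrightarrow> (\<And>p w. opair p w \<in> elts x \<Longrightarrow> w \<in> elts t) \<Longrightarrow>
    subname_closed (vset (insert x (elts t)))"
  unfolding subname_closed_def elts_vset_insert by blast

lemma namelike_finite:
  assumes "finite A" "A \<subseteq> namelike"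
  shows "\<exists>t. A \<subseteq> elts t \<and> subname_closed t"
  using assms
proof (induction rule: finite_induct)
  case empty
  have "subname_closed (vset {})" unfolding subname_closed_def by simp
  then show ?case by blast
next
  case (insert x A)
  then obtain t t' where "A \<subseteq> elts t" "subname_closed t" "x \<in> elts t'" "subname_closed t'"
    unfolding namelike_def by auto
  then show ?case
    using subname_closed_Un [of t t'] elts_vset_Un [of t t'] by blast
qed

lemma feq_namelike: "feq x y p \<Longrightarrow> x \<in> namelike \<and> y \<in> namelike"
  unfolding feq_def namelike_def by blast

lemma eq_relation_finite:
  assumes "finite A" "A \<subseteq> namelike"
  obtains t R where "A \<subseteq> elts t" "subname_closed t" "eq_relation t R"
  using namelike_finite [OF assms] eq_relation_exists by blast

lemma eq_relation_pair:
  assumes "x \<in> namelike" "y \<in> namelike"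
  obtains t R where "x \<in> elts t" "y \<in> elts t" "subname_closed t" "eq_relation t R"
proof -
  obtain t R where "{x, y} \<subseteq> elts t" "subname_closed t" "eq_relation t R"
    by (rule eq_relation_finite [of "{x, y}"]) (use assms in simp_all)
  then show thesis by (intro that) simp_all
qed

lemma feq_refl:
  assumes "x \<in> namelike" "p \<in> elts P"
  shows "feq x x p"
proof -
  obtain t R where t: "x \<in> elts t" "subname_closed t" "eq_relation t R"
    using assms(1,1) by (rule eq_relation_pair)
  have "\<forall>p\<in>elts P. opair p (opair x x) \<in> elts R"
  proof (rule subname_induct [OF _ t(1)])
    show "definable (\<lambda>s. \<not> (\<forall>p\<in>elts P. opair p (opair (s 0) (s 0)) \<in> elts R))"
      by (rule definable_intros)+
  next
    fix u assume u: "u \<in> elts t" and IH: "\<And>s z. opair s z \<in> elts u \<Longrightarrow> z \<in> elts t \<Longrightarrow>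
      \<forall>p\<in>elts P. opair p (opair z z) \<in> elts R"
    have "eq_half R p u u" for p
      unfolding eq_half_def
      using IH subname_closedD [OF t(2) u] leq_refl leq_dom(1) by blast
    then show "\<forall>p\<in>elts P. opair p (opair u u) \<in> elts R"
      using eq_relationD [OF t(3) _ u u] by blast
  qed
  then show ?thesis using feq_iff [OF t(2,3,1,1)] assms(2) by blast
qed

lemma feq_sym:
  assumes "feq x y p" "p \<in> elts P"
  shows "feq y x p"
proof -
  obtain t R where t: "x \<in> elts t" "y \<in> elts t" "subname_closed t" "eq_relation t R"
    by (rule eq_relation_pair [of x y]) (use feq_namelike [OF assms(1)] in simp_all)
  then show ?thesis
    using assms feq_iff [OF t(3,4)] eq_relation_sym [OF t(4)] by blast
qed

lemma feq_mono:
  assumes "feq x y p" "leq q p"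
  shows "feq x y q"
proof -
  obtain t R where t: "x \<in> elts t" "y \<in> elts t" "subname_closed t" "eq_relation t R"
    by (rule eq_relation_pair [of x y]) (use feq_namelike [OF assms(1)] in simp_all)
  then show ?thesis
    using assms feq_iff [OF t(3,4,1,2)] eq_relationD [OF t(4) _ t(1,2)] eq_half_leq leq_dom by metis
qed

lemma feq_trans:
  assumes "feq x y p" "feq y z p" "p \<in> elts P"
  shows "feq x z p"
proof -
  obtain t R where "{x, y, z} \<subseteq> elts t" and t': "subname_closed t" "eq_relation t R"
    by (rule eq_relation_finite [of "{x, y, z}"])
      (use feq_namelike [OF assms(1)] feq_namelike [OF assms(2)] in simp_all)
  then have t: "x \<in> elts t" "y \<in> elts t" "z \<in> elts t" "subname_closed t" "eq_relation t R"
    by simp_all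
  let ?R = "\<lambda>p u v. opair p (opair u v) \<in> elts R"
  have "\<forall>v\<in>elts t. \<forall>w\<in>elts t. \<forall>p\<in>elts P. ?R p x v \<and> ?R p v w \<longrightarrow> ?R p x w"
  proof (rule subname_induct [OF _ t(1)])
    show "definable (\<lambda>s. \<not> (\<forall>v\<in>elts t. \<forall>w\<in>elts t. \<forall>p\<in>elts P. ?R p (s 0) v \<and> ?R p v w \<longrightarrow> ?R p (s 0) w))"
      by (rule definable_intros)+
  next
    fix u assume u: "u \<in> elts t" and IH: "\<And>s z. opair s z \<in> elts u \<Longrightarrow> z \<in> elts t \<Longrightarrow>
      \<forall>v\<in>elts t. \<forall>w\<in>elts t. \<forall>p\<in>elts P. ?R p z v \<and> ?R p v w \<longrightarrow> ?R p z w"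
    show "\<forall>v\<in>elts t. \<forall>w\<in>elts t. \<forall>p\<in>elts P. ?R p u v \<and> ?R p v w \<longrightarrow> ?R p u w"
    proof (intro ballI impI, elim conjE)
      fix v w p assume v: "v \<in> elts t" and w: "w \<in> elts t" and p: "p \<in> elts P"
        and "?R p u v" "?R p v w"
      then have uv: "eq_half R p u v" and vu: "eq_half R p v u"
        and vw: "eq_half R p v w" and wv: "eq_half R p w v"
        using eq_relationD [OF t(5)] u by blast+
      have mono: "?R r a b" if "?R q a b" "leq r q" "a \<in> elts t" "b \<in> elts t" for q r a b
        using that eq_relationD [OF t(5)] eq_half_leq leq_dom by metis
      have "eq_half R p u w"
        unfolding eq_half_def
      proof (intro allI impI, elim conjE)
        fix s a q assume a: "opair s a \<in> elts u" and q: "leq q p" "leq q s"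
        obtain r s' b where r: "leq r q" "opair s' b \<in> elts v" "leq r s'" "?R r a b"
          using eq_halfE [OF uv a q] by blast
        obtain r' s'' c where r': "leq r' r" "opair s'' c \<in> elts w" "leq r' s''" "?R r' b c"
          using eq_halfE [OF vw r(2) leq_trans [OF r(1) q(1)] r(3)] by blast
        have abc: "a \<in> elts t" "b \<in> elts t" "c \<in> elts t"
          using subname_closedD [OF t(4)] u v w a r(2) r'(2) by blast+
        then have "?R r' a c"
          using IH [OF a] mono [OF r(4) r'(1)] r'(4) leq_dom(1) [OF r'(1)] by blast
        then show "\<exists>r s' c. leq r q \<and> opair s' c \<in> elts w \<and> leq r s' \<and> ?R r a c"
          using leq_trans [OF r'(1) r(1)] r'(2,3) by blast
      qed
      moreover have "eq_half R p w u"
        unfolding eq_half_def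
      proof (intro allI impI, elim conjE)
        fix s a q assume a: "opair s a \<in> elts w" and q: "leq q p" "leq q s"
        obtain r s' b where r: "leq r q" "opair s' b \<in> elts v" "leq r s'" "?R r a b"
          using eq_halfE [OF wv a q] by blast
        obtain r' s'' c where r': "leq r' r" "opair s'' c \<in> elts u" "leq r' s''" "?R r' b c"
          using eq_halfE [OF vu r(2) leq_trans [OF r(1) q(1)] r(3)] by blast
        have abc: "a \<in> elts t" "b \<in> elts t" "c \<in> elts t"
          using subname_closedD [OF t(4)] u v w a r(2) r'(2) by blast+
        have P: "r' \<in> elts P" using r'(1) by (rule leq_dom)
        \<comment> \<open>The induction hypothesis is available only at \<open>c\<close>, the
          subname of \<open>u\<close>. So the chain is reversed, composed, and reversed
          back.\<close>
        have "?R r' c b" "?R r' b a"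
          using mono [OF r(4) r'(1)] r'(4) eq_relation_sym [OF t(5) P] abc by blast+
        then have "?R r' c a"
          using IH [OF r'(2)] abc P by blast
        then have "?R r' a c" using eq_relation_sym [OF t(5) P] abc by blast
        then show "\<exists>r s' c. leq r q \<and> opair s' c \<in> elts u \<and> leq r s' \<and> ?R r a c"
          using leq_trans [OF r'(1) r(1)] r'(2,3) by blast
      qed
      ultimately show "?R p u w" using eq_relationD [OF t(5) p u w] by blast
    qed
  qed
  then show ?thesis using feq_iff [OF t(4,5)] t assms by blast
qed

definition feq_half :: "'v \<Rightarrow> 'v \<Rightarrow> 'v \<Rightarrow> bool" where
  "feq_half x y p \<longleftrightarrow> (\<forall>s z q. opair s z \<in> elts x \<longrightarrow> leq q p \<longrightarrow> leq q s \<longrightarrow>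
     (\<exists>r s' w. leq r q \<and> opair s' w \<in> elts y \<and> leq r s' \<and> feq z w r))"

lemma feq_rec:
  assumes "x \<in> namelike" "y \<in> namelike" "p \<in> elts P"
  shows "feq x y p \<longleftrightarrow> feq_half x y p \<and> feq_half y x p"
proof -
  obtain t R where t: "x \<in> elts t" "y \<in> elts t" "subname_closed t" "eq_relation t R"
    using assms(1,2) by (rule eq_relation_pair)
  have "eq_half R p u v \<longleftrightarrow> feq_half u v p" if "u \<in> elts t" "v \<in> elts t" for u v
  proof -
    have "feq z w r \<longleftrightarrow> opair r (opair z w) \<in> elts R"
      if "opair s z \<in> elts u" "opair s' w \<in> elts v" "leq r q" for s z s' w r q
      using subname_closedD [OF t(3)] \<open>u \<in> elts t\<close> \<open>v \<in> elts t\<close> that leq_dom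
      by (intro feq_iff [OF t(3,4)]) blast+
    then show ?thesis unfolding eq_half_def feq_half_def by blast
  qed
  then show ?thesis
    using feq_iff [OF t(3,4,1,2) assms(3)] eq_relationD [OF t(4) assms(3) t(1,2)] t(1,2) by blast
qed

text \<open>No induction on names is involved: a half of the recursion asks for witnesses below
  arbitrary stronger conditions, and witnesses found below a dense set of conditions serve equally
  well.\<close>

lemma feq_dense:
  assumes "p \<in> elts P" "\<And>q. leq q p \<Longrightarrow> \<exists>r. leq r q \<and> feq x y r"
  shows "feq x y p"
proof -
  obtain r where "feq x y r" using assms leq_refl by blast
  then have xy: "x \<in> namelike" "y \<in> namelike" using feq_namelike by blast+
  have half: "feq_half u v p" if dense: "\<And>q. leq q p \<Longrightarrow> \<exists>r. leq r q \<and> feq_half u v r" for u v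
    unfolding feq_half_def
  proof (intro allI impI)
    fix s z q assume z: "opair s z \<in> elts u" "leq q p" "leq q s"
    obtain r where r: "leq r q" "feq_half u v r" using dense [OF z(2)] by blast
    then obtain r' s' w where "leq r' r" "opair s' w \<in> elts v" "leq r' s'" "feq z w r'"
      using z(1) leq_trans [OF r(1) z(3)] leq_refl [OF leq_dom(1) [OF r(1)]]
      unfolding feq_half_def by blast
    then show "\<exists>r s' w. leq r q \<and> opair s' w \<in> elts v \<and> leq r s' \<and> feq z w r"
      using r(1) leq_trans by blast
  qed
  have "feq_half x y p" "feq_half y x p"
    using assms(2) feq_rec [OF xy] leq_dom(1) by (intro half; blast)+
  then show ?thesis using feq_rec [OF xy assms(1)] by blast
qed

lemma fmem_mono: "fmem x y p \<Longrightarrow> leq q p \<Longrightarrow> fmem x y q"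
  unfolding fmem_def using leq_trans by blast

lemma fmem_feq:
  assumes "fmem a x p" "feq x y p"
  shows "fmem a y p"
  unfolding fmem_def
proof (intro allI impI)
  fix q assume q: "leq q p"
  then obtain r s z where r: "leq r q" "opair s z \<in> elts x" "leq r s" "feq a z r"
    using assms(1) unfolding fmem_def by blast
  have "p \<in> elts P" using q by (rule leq_dom)
  then have "feq_half x y p" using feq_rec feq_namelike assms(2) by blast
  then obtain r' s' w where r': "leq r' r" "opair s' w \<in> elts y" "leq r' s'" "feq z w r'"
    using r(2,3) leq_trans [OF r(1) q] unfolding feq_half_def by blast
  have "feq a w r'"
    using feq_trans [OF feq_mono [OF r(4) r'(1)] r'(4)] leq_dom(1) [OF r'(1)] by blast
  then show "\<exists>r s w. leq r q \<and> opair s w \<in> elts y \<and> leq r s \<and> feq a w r"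
    using r' leq_trans [OF r'(1) r(1)] by blast
qed


section \<open>The forcing language\<close>

text \<open>Implication is defined through negation, so its conclusion is obtained only densely.
  Hence \<open>fimpI\<close> may work at one condition, while \<open>fballD\<close> has to pass to a
  stronger one.\<close>

lemma fimp_iff: "fimp A B p \<longleftrightarrow> (\<forall>q. leq q p \<longrightarrow> A q \<longrightarrow> (\<exists>r. leq r q \<and> B r))"
  unfolding fimp_def fnot_def fand_def by blast

lemma fimpI:
  assumes "\<And>q. leq q p \<Longrightarrow> A q \<Longrightarrow> B q"
  shows "fimp A B p"
  unfolding fimp_iff using assms leq_refl leq_dom(1) by blast

lemma fex_iff: "fex X \<Phi> p \<longleftrightarrow> (\<forall>q. leq q p \<longrightarrow> (\<exists>x\<in>X. \<exists>r. leq r q \<and> \<Phi> x r))"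
  unfolding fex_def fnot_def fall_def by blast

lemma fballI:
  assumes "\<And>x q. x \<in> names \<Longrightarrow> leq q p \<Longrightarrow> fmem x a q \<Longrightarrow> \<Phi> x q"
  shows "fball a \<Phi> p"
  unfolding fball_def fall_def using assms by (intro ballI fimpI)

lemma fballD:
  assumes "fball a \<Phi> p" "x \<in> names" "leq q p" "fmem x a q"
  obtains r where "leq r q" "\<Phi> x r"
  using assms unfolding fball_def fall_def fimp_iff by blast

lemma fbex_iff:
  "fbex a \<Phi> p \<longleftrightarrow> (\<forall>q. leq q p \<longrightarrow> (\<exists>x\<in>names. \<exists>r. leq r q \<and> fmem x a r \<and> \<Phi> x r))"
  unfolding fbex_def fex_iff fand_def by (rule refl)

lemma fbexI:
  assumes "x \<in> names" "\<And>q. leq q p \<Longrightarrow> fmem x a q" "\<And>q. leq q p \<Longrightarrow> \<Phi> x q"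
  shows "fbex a \<Phi> p"
  unfolding fbex_iff using assms leq_refl leq_dom(1) by blast

lemma fmem_dense:
  assumes "\<And>q. leq q p \<Longrightarrow> \<exists>r. leq r q \<and> fmem x y r"
  shows "fmem x y p"
  unfolding fmem_def
proof (intro allI impI)
  fix q assume "leq q p"
  then obtain r where r: "leq r q" "fmem x y r" using assms by blast
  then obtain r' s z where "leq r' r" "opair s z \<in> elts y" "leq r' s" "feq x z r'"
    using leq_refl leq_dom(1) unfolding fmem_def by blast
  then show "\<exists>r s z. leq r q \<and> opair s z \<in> elts y \<and> leq r s \<and> feq x z r"
    using leq_trans r(1) by blast
qed

section \<open>Names with trivial conditions\<close>

definition sing :: "'v \<Rightarrow> 'v" where
  "sing x = vset {opair one x}"

lemma elts_sing [simp]: "elts (sing x) = {opair one x}"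
  unfolding sing_def by simp

text \<open>Hereditarily, \<open>one\<close> is the only condition used, as in canonical names of
  sets in \<open>V\<close>. The names chosen for the decomposition belong to this class.\<close>

definition one_names :: "'v set" where
  "one_names = {x. \<exists>t. x \<in> elts t \<and> (\<forall>y\<in>elts t. \<forall>z\<in>elts y. \<exists>w\<in>elts t. z = opair one w)}"

lemma zero_one_name: "zero \<in> one_names"
proof -
  have "\<forall>y\<in>elts (vset {zero}). \<forall>z\<in>elts y. \<exists>w\<in>elts (vset {zero}). z = opair one w"
    unfolding zero_def by simp
  moreover have "zero \<in> elts (vset {zero})" by simp
  ultimately show ?thesis unfolding one_names_def by (intro CollectI exI conjI)
qed

lemma sing_one_name:
  assumes "x \<in> one_names"
  shows "sing x \<in> one_names"
proof -
  obtain t where t: "x \<in> elts t" "\<forall>y\<in>elts t. \<forall>z\<in>elts y. \<exists>w\<in>elts t. z = opair one w"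
    using assms unfolding one_names_def by blast
  define t' where "t' = vset (insert (sing x) (elts t))"
  have t': "elts t' = insert (sing x) (elts t)" unfolding t'_def by (rule elts_vset_insert)
  have "\<forall>y\<in>elts t'. \<forall>z\<in>elts y. \<exists>w\<in>elts t'. z = opair one w"
    using t unfolding t' by auto
  then show ?thesis unfolding one_names_def using t' by blast
qed

lemma one_names_subset_names: "one_names \<subseteq> names"
  unfolding one_names_def names_def using one_in_P by blast

lemma names_subset_namelike: "names \<subseteq> namelike"
proof
  fix x assume "x \<in> names"
  then obtain t where t: "x \<in> elts t" "\<forall>y\<in>elts t. \<forall>z\<in>elts y. \<exists>p\<in>elts P. \<exists>w\<in>elts t. z = opair p w"
    unfolding names_def by blast
  then have "subname_closed t" unfolding subname_closed_def by fastforce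
  then show "x \<in> namelike" using t(1) unfolding namelike_def by blast
qed

text \<open>Since \<open>\<sigma>\<close> fixes \<open>one\<close>, the identity on a closed set
  satisfies the recursion for \<open>act\<close>. By induction on subnames, any other solution has
  the same value at \<open>x\<close>, which settles the definite description.\<close>

lemma act_one_name:
  assumes x: "x \<in> one_names" and \<sigma>: "app \<sigma> one = one"
  shows "act \<sigma> x = x"
proof -
  obtain t where t: "x \<in> elts t" "\<And>y z. y \<in> elts t \<Longrightarrow> z \<in> elts y \<Longrightarrow> \<exists>w\<in>elts t. z = opair one w"
    using x unfolding one_names_def by blast
  have sub: "p = one \<and> w \<in> elts t" if "u \<in> elts t" "opair p w \<in> elts u" for u p w
    using t(2) [OF that] by auto
  have closed: "subname_closed t" using sub unfolding subname_closed_def by blast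
  define f where "f = vset {opair a a |a. a \<in> elts t}"
  have f: "is_fun f t" "\<And>a. a \<in> elts t \<Longrightarrow> app f a = a"
    unfolding f_def by (rule is_fun_graph [of "\<lambda>a. a", OF fterm_var], assumption?)+
  have eq: "{opair (app \<sigma> p) (app g w) |p w. opair p w \<in> elts u} = elts u"
    if u: "u \<in> elts t" and g: "\<And>p w. opair p w \<in> elts u \<Longrightarrow> app g w = w" for g u
  proof (intro equalityI subsetI)
    fix z assume "z \<in> {opair (app \<sigma> p) (app g w) |p w. opair p w \<in> elts u}"
    then obtain p w where "z = opair (app \<sigma> p) (app g w)" "opair p w \<in> elts u" by blast
    then show "z \<in> elts u" using sub [OF u] g \<sigma> by metis
  next
    fix z assume z: "z \<in> elts u"
    then obtain w where w: "z = opair one w" using t(2) [OF u] by blast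
    then have "z = opair (app \<sigma> one) (app g w)" "opair one w \<in> elts u" using z g \<sigma> by simp_all
    then show "z \<in> {opair (app \<sigma> p) (app g w) |p w. opair p w \<in> elts u}"
      by (intro CollectI exI conjI)
  qed
  show ?thesis
    unfolding act_def
  proof (rule the_equality)
    show "\<exists>t f. x \<in> elts t \<and> subname_closed t \<and> is_fun f t \<and>
       (\<forall>u\<in>elts t. elts (app f u) = {opair (app \<sigma> p) (app f w) |p w. opair p w \<in> elts u}) \<and>
       x = app f x"
    proof (intro exI conjI ballI)
      fix u assume u: "u \<in> elts t"
      show "elts (app f u) = {opair (app \<sigma> p) (app f w) |p w. opair p w \<in> elts u}"
        using eq [OF u, of f] sub [OF u] f(2) u by simp
    qed (use t(1) closed f in simp_all)
  next
    fix y assume "\<exists>t f. x \<in> elts t \<and> subname_closed t \<and> is_fun f t \<and>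
       (\<forall>u\<in>elts t. elts (app f u) = {opair (app \<sigma> p) (app f w) |p w. opair p w \<in> elts u}) \<and>
       y = app f x"
    then obtain t' g where t': "x \<in> elts t'" "subname_closed t'" "is_fun g t'" "y = app g x"
      "\<And>u. u \<in> elts t' \<Longrightarrow> elts (app g u) = {opair (app \<sigma> p) (app g w) |p w. opair p w \<in> elts u}"
      by blast
    \<comment> \<open>The claim avoids \<open>app\<close>, so its definability follows from the
      introduction rules.\<close>
    have "x \<in> elts t' \<longrightarrow> opair x x \<in> elts g"
    proof (rule subname_induct [of "\<lambda>x. x \<in> elts t' \<longrightarrow> opair x x \<in> elts g", OF _ t(1)])
      show "definable (\<lambda>s. \<not> (s 0 \<in> elts t' \<longrightarrow> opair (s 0) (s 0) \<in> elts g))"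
        by (rule definable_intros)+
    next
      fix u assume u: "u \<in> elts t"
        and IH: "\<And>p z. opair p z \<in> elts u \<Longrightarrow> z \<in> elts t \<Longrightarrow> z \<in> elts t' \<longrightarrow> opair z z \<in> elts g"
      show "u \<in> elts t' \<longrightarrow> opair u u \<in> elts g"
      proof
        assume u': "u \<in> elts t'"
        have "app g w = w" if "opair p w \<in> elts u" for p w
          using IH [OF that] sub [OF u that] subname_closedD [OF t'(2) u' that] app_equality [OF t'(3)]
          by blast
        then have "app g u = u"
          using eq [OF u] t'(5) [OF u'] by (intro extensionality) simp
        then show "opair u u \<in> elts g" using opair_app [OF t'(3) u'] by simp
      qed
    qed
    then show "y = x" using t'(1,4) app_equality [OF t'(3)] by blast
  qed
qed

lemma fmem_sing_iff: "fmem x (sing z) p \<longleftrightarrow> (\<forall>q. leq q p \<longrightarrow> (\<exists>r. leq r q \<and> feq x z r))"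
  unfolding fmem_def using leq_one leq_dom(1) by simp blast

lemma fmem_singD: "fmem x (sing z) p \<Longrightarrow> leq q p \<Longrightarrow> \<exists>r. leq r q \<and> feq x z r"
  unfolding fmem_sing_iff by blast

lemma fmem_singI: "feq x z p \<Longrightarrow> fmem x (sing z) p"
  unfolding fmem_sing_iff using feq_mono leq_refl leq_dom(1) by blast

lemma fmem_sing_self: "x \<in> names \<Longrightarrow> p \<in> elts P \<Longrightarrow> fmem x (sing x) p"
  using fmem_singI feq_refl names_subset_namelike by blast

text \<open>When subnames can be matched at \<open>p\<close> itself with condition
  \<open>one\<close>, no further strengthening is required and both halves of the recursion hold at
  once.\<close>

lemma feq_one_names:
  assumes "a \<in> namelike" "b \<in> namelike" "p \<in> elts P"
    and "\<And>s z. opair s z \<in> elts a \<Longrightarrow> \<exists>w. opair one w \<in> elts b \<and> feq z w p"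
    and "\<And>s z. opair s z \<in> elts b \<Longrightarrow> \<exists>w. opair one w \<in> elts a \<and> feq z w p"
  shows "feq a b p"
proof -
  have half: "feq_half u v p"
    if *: "\<And>s z. opair s z \<in> elts u \<Longrightarrow> \<exists>w. opair one w \<in> elts v \<and> feq z w p" for u v
    unfolding feq_half_def
  proof (intro allI impI)
    fix s z q assume "opair s z \<in> elts u" "leq q p"
    moreover from this obtain w where "opair one w \<in> elts v" "feq z w p" using * by blast
    ultimately show "\<exists>r s' w. leq r q \<and> opair s' w \<in> elts v \<and> leq r s' \<and> feq z w r"
      using leq_refl leq_one leq_dom(1) feq_mono by blast
  qed
  show ?thesis
    unfolding feq_rec [OF assms(1-3)] using half assms(4,5) by blast
qed

lemma namelike_pair:
  assumes "x \<in> namelike" "y \<in> namelike"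
  shows "vset {opair one x, opair one y} \<in> namelike"
proof -
  obtain t R where t: "x \<in> elts t" "y \<in> elts t" "subname_closed t" "eq_relation t R"
    by (rule eq_relation_pair [OF assms])
  have "subname_closed (vset (insert (vset {opair one x, opair one y}) (elts t)))"
    using t by (intro subname_closed_insert) auto
  then show ?thesis unfolding namelike_def using elts_vset_insert by blast
qed

lemma feq_pair:
  assumes "feq x a p" "feq y b p" "p \<in> elts P"
  shows "feq (vset {opair one x, opair one y}) (vset {opair one a, opair one b}) p"
  using feq_namelike [OF assms(1)] feq_namelike [OF assms(2)] assms feq_sym
  by (intro feq_one_names namelike_pair) auto

lemma feq_pair_name:
  assumes "feq x a p" "feq y b p" "p \<in> elts P"
  shows "feq (pair_name x y) (pair_name a b) p"
  \<comment> \<open>The singleton inside a Kuratowski pair is treated as the pair of a name with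
    itself.\<close>
  using feq_pair [OF feq_pair [OF assms(1,1,3)] feq_pair [OF assms] assms(3)]
  unfolding pair_name_def by simp

section \<open>The name of the trivial forcing notion\<close>

definition trivial :: "'v" where "trivial = sing zero"

text \<open>Both the order of the trivial forcing notion and its identity automorphism are
  \<open>{(0,0)}\<close>.\<close>

definition diagonal :: "'v" where "diagonal = sing (pair_name zero zero)"

definition trivial_group :: "'v" where "trivial_group = sing diagonal"

lemma pair_name_zero: "pair_name zero zero = sing (sing zero)"
  unfolding pair_name_def sing_def by simp

lemma one_name_constants:
  "trivial \<in> one_names" "diagonal \<in> one_names" "trivial_group \<in> one_names" "pair_name zero zero \<in> one_names"
  unfolding trivial_group_def diagonal_def trivial_def pair_name_zero
  by (intro sing_one_name zero_one_name)+

lemmas name_constants = subsetD [OF one_names_subset_names zero_one_name]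
  one_name_constants [THEN subsetD [OF one_names_subset_names]]

lemma zero_in_trivial: "p \<in> elts P \<Longrightarrow> fmem zero trivial p"
  unfolding trivial_def by (intro fmem_sing_self name_constants)

text \<open>Membership in \<open>{0}\<close> gives equality with \<open>0\<close> only densely, so
  two names require two successive refinements.\<close>

lemma in_trivial_dense:
  assumes "fmem x trivial p" "fmem y trivial p" "leq q p"
  obtains r where "leq r q" "feq x zero r" "feq y zero r"
proof -
  obtain r where r: "leq r q" "feq x zero r"
    using fmem_singD assms(1,3) unfolding trivial_def by blast
  obtain r' where r': "leq r' r" "feq y zero r'"
    using fmem_singD [OF assms(2) [unfolded trivial_def] leq_trans [OF r(1) assms(3)]] by blast
  show thesis
    using that [OF leq_trans [OF r'(1) r(1)] feq_mono [OF r(2) r'(1)] r'(2)] .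
qed

lemma trivial_eq_dense:
  assumes "fmem x trivial p" "fmem y trivial p" "leq q p"
  shows "\<exists>r. leq r q \<and> feq x y r"
proof -
  obtain r where r: "leq r q" "feq x zero r" "feq y zero r" using in_trivial_dense [OF assms] .
  have "feq x y r"
    using feq_trans [OF r(2) feq_sym [OF r(3)]] leq_dom(1) [OF r(1)] by blast
  then show ?thesis using r(1) by blast
qed

text \<open>Members of \<open>{0}\<close> form a single possible pair. Most axioms for the order and
  for the automorphisms reduce to this fact.\<close>

lemma pair_in_diagonal:
  assumes "fmem x trivial p" "fmem y trivial p"
  shows "fpair_in x y diagonal p"
  unfolding fpair_in_def diagonal_def fmem_sing_iff
proof (intro allI impI)
  fix q assume "leq q p"
  then obtain r where r: "leq r q" "feq x zero r" "feq y zero r" using in_trivial_dense [OF assms] by blast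
  then show "\<exists>r. leq r q \<and> feq (pair_name x y) (pair_name zero zero) r"
    using feq_pair_name leq_dom(1) by blast
qed

lemma in_diagonal:
  assumes "fmem z diagonal p"
  shows "fbex trivial (\<lambda>x. fbex trivial (\<lambda>y. feq z (pair_name x y))) p"
  unfolding fbex_iff [of _ _ p]
proof (intro allI impI)
  fix q assume "leq q p"
  then obtain r where r: "leq r q" "feq z (pair_name zero zero) r"
    using fmem_singD assms unfolding diagonal_def by blast
  have "fbex trivial (\<lambda>y. feq z (pair_name zero y)) r"
    using feq_mono [OF r(2)] zero_in_trivial leq_dom(1) by (intro fbexI [of zero] name_constants) blast+
  then show "\<exists>x\<in>names. \<exists>r. leq r q \<and> fmem x trivial r \<and> fbex trivial (\<lambda>y. feq z (pair_name x y)) r"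
    using r(1) zero_in_trivial leq_dom(1) name_constants(1) by blast
qed

text \<open>A member of the group is densely equal to \<open>diagonal\<close>. Since membership is
  itself determined densely, the two names have the same forced members at \<open>p\<close>.\<close>

lemma group_mem_iff:
  assumes "fmem f trivial_group p"
  shows "fmem z f p \<longleftrightarrow> fmem z diagonal p"
proof
  assume z: "fmem z f p"
  show "fmem z diagonal p"
  proof (rule fmem_dense)
    fix q assume "leq q p"
    then obtain r where r: "leq r q" "feq f diagonal r"
      using assms fmem_singD unfolding trivial_group_def by blast
    then show "\<exists>r. leq r q \<and> fmem z diagonal r"
      using fmem_feq [OF fmem_mono [OF z leq_trans [OF r(1) \<open>leq q p\<close>]] r(2)] by blast
  qed
next
  assume z: "fmem z diagonal p"
  show "fmem z f p"
  proof (rule fmem_dense)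
    fix q assume "leq q p"
    then obtain r where r: "leq r q" "feq f diagonal r"
      using assms fmem_singD unfolding trivial_group_def by blast
    then show "\<exists>r. leq r q \<and> fmem z f r"
      using fmem_feq [OF fmem_mono [OF z leq_trans [OF r(1) \<open>leq q p\<close>]] feq_sym [OF r(2)]] leq_dom(1)
      by blast
  qed
qed

lemma pair_in_group_element:
  "fmem f trivial_group p \<Longrightarrow> fmem x trivial p \<Longrightarrow> fmem y trivial p \<Longrightarrow> fpair_in x y f p"
  using pair_in_diagonal unfolding fpair_in_def by (simp only: group_mem_iff)

lemma trivial_forcing_notion:
  assumes "p \<in> elts P"
  shows "f_forcing_notion trivial diagonal zero p"
  unfolding f_forcing_notion_def frelation_on_def fand_def [of _ _ p]
proof (intro conjI)
  show "fball diagonal (\<lambda>z. fbex trivial (\<lambda>x. fbex trivial (\<lambda>y. feq z (pair_name x y)))) p"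
    by (intro fballI in_diagonal)
  show "fball trivial (\<lambda>x. fpair_in x x diagonal) p"
    by (intro fballI pair_in_diagonal)
  show "fball trivial (\<lambda>x. fball trivial (\<lambda>y. fball trivial (\<lambda>z.
      fimp (fand (fpair_in x y diagonal) (fpair_in y z diagonal)) (fpair_in x z diagonal)))) p"
    by (intro fballI fimpI pair_in_diagonal) (meson fmem_mono leq_trans)+
  show "fmem zero trivial p" using assms by (rule zero_in_trivial)
  show "fball trivial (\<lambda>x. fpair_in x zero diagonal) p"
    by (intro fballI pair_in_diagonal zero_in_trivial) (simp_all add: leq_dom)
qed

text \<open>All equivalences needed here are between densely true statements.\<close>

lemma fiffI:
  assumes "\<And>q. leq q p \<Longrightarrow> \<exists>r. leq r q \<and> A r" "\<And>q. leq q p \<Longrightarrow> \<exists>r. leq r q \<and> B r"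
  shows "fiff A B p"
  unfolding fiff_def fand_def fimp_iff using assms by simp

lemma fiffI':
  assumes "\<And>q. leq q p \<Longrightarrow> A q" "\<And>q. leq q p \<Longrightarrow> B q"
  shows "fiff A B p"
  using assms leq_refl leq_dom(1) by (intro fiffI) blast+

lemma group_element_automorphism:
  assumes f: "fmem f trivial_group p" and p: "p \<in> elts P"
  shows "f_automorphism trivial diagonal zero f p"
  unfolding f_automorphism_def frelation_on_def fand_def [of _ _ p]
proof (intro conjI)
  have f': "fmem f trivial_group q" if "leq q p" for q using fmem_mono [OF f that] .
  show "fball f (\<lambda>z. fbex trivial (\<lambda>x. fbex trivial (\<lambda>y. feq z (pair_name x y)))) p"
    using group_mem_iff f' by (intro fballI in_diagonal) blast
  show "fball trivial (\<lambda>x. fbex trivial (\<lambda>y. fpair_in x y f)) p"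
  proof (intro fballI fbexI [of zero] name_constants zero_in_trivial pair_in_group_element)
    fix x q r assume "leq q p" "fmem x trivial q" "leq r q"
    then show "fmem f trivial_group r" "fmem x trivial r" "r \<in> elts P" "r \<in> elts P"
      using f' leq_trans fmem_mono leq_dom(1) by blast+
  qed
  show "fball trivial (\<lambda>y. fbex trivial (\<lambda>x. fpair_in x y f)) p"
  proof (intro fballI fbexI [of zero] name_constants zero_in_trivial pair_in_group_element)
    fix x q r assume "leq q p" "fmem x trivial q" "leq r q"
    then show "fmem f trivial_group r" "fmem x trivial r" "r \<in> elts P" "r \<in> elts P"
      using f' leq_trans fmem_mono leq_dom(1) by blast+
  qed
  show "fball trivial (\<lambda>x. fball trivial (\<lambda>x'. fball trivial (\<lambda>y. fball trivial (\<lambda>y'.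
             fimp (fand (fpair_in x y f) (fpair_in x' y' f))
                  (fand (fiff (feq x x') (feq y y'))
                        (fiff (fpair_in x x' diagonal) (fpair_in y y' diagonal))))))) p"
  proof (intro fballI fimpI)
    fix x1 q1 x2 q2 x3 q3 x4 q4 q
    assume "fmem x1 trivial q1" "leq q2 q1" "fmem x2 trivial q2" "leq q3 q2" "fmem x3 trivial q3"
      "leq q4 q3" "fmem x4 trivial q4" "leq q q4"
    then have x: "fmem x1 trivial q" "fmem x2 trivial q" "fmem x3 trivial q" "fmem x4 trivial q"
      by (meson fmem_mono leq_trans)+
    have "fiff (feq x1 x2) (feq x3 x4) q"
      using x trivial_eq_dense by (intro fiffI)
    moreover have "fiff (fpair_in x1 x2 diagonal) (fpair_in x3 x4 diagonal) q"
      using x fmem_mono by (intro fiffI' pair_in_diagonal) blast+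
    ultimately show "fand (fiff (feq x1 x2) (feq x3 x4))
        (fiff (fpair_in x1 x2 diagonal) (fpair_in x3 x4 diagonal)) q"
      unfolding fand_def by blast
  qed
  show "fpair_in zero zero f p"
    using p by (intro pair_in_group_element f zero_in_trivial)
qed

lemma f_comp_diagonal: "p \<in> elts P \<Longrightarrow> f_comp trivial f g diagonal p"
  unfolding f_comp_def
  by (intro fballI fimpI pair_in_diagonal) (meson fmem_mono leq_trans)+

lemma diagonal_in_group: "p \<in> elts P \<Longrightarrow> fmem diagonal trivial_group p"
  unfolding trivial_group_def by (intro fmem_sing_self name_constants)

lemma trivial_group_is_group:
  assumes "p \<in> elts P"
  shows "f_automorphism_group trivial diagonal zero trivial_group p"
  unfolding f_automorphism_group_def fand_def [of _ _ p]
proof (intro conjI)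
  show "fball trivial_group (f_automorphism trivial diagonal zero) p"
    by (intro fballI group_element_automorphism) (simp_all add: leq_dom)
  show "fbex trivial_group (\<lambda>e. fball trivial (\<lambda>x. fpair_in x x e)) p"
    by (intro fbexI [of diagonal] name_constants diagonal_in_group fballI pair_in_diagonal)
      (simp_all add: leq_dom)
  show "fball trivial_group (\<lambda>f. fbex trivial_group (\<lambda>g. fball trivial (\<lambda>x. fball trivial (\<lambda>y.
      fimp (fpair_in x y f) (fpair_in y x g))))) p"
    by (intro fballI fbexI [of diagonal] name_constants diagonal_in_group fimpI pair_in_diagonal)
      (meson fmem_mono leq_trans leq_dom)+
  show "fball trivial_group (\<lambda>f. fball trivial_group (\<lambda>g. fbex trivial_group (f_comp trivial f g))) p"
    by (intro fballI fbexI [of diagonal] name_constants diagonal_in_group f_comp_diagonal)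
      (simp_all add: leq_dom)
qed

lemma f_image_fixed_trivial: "f_image_fixed trivial f trivial p"
  unfolding f_image_fixed_def
  by (intro fballI fimpI fiffI') (meson fmem_mono leq_trans)+

lemma f_filter_trivial:
  assumes "p \<in> elts P"
  shows "f_filter trivial diagonal zero trivial p"
  unfolding f_filter_def fsubset_def fand_def [of _ _ p]
proof (intro conjI)
  show "fball trivial (\<lambda>x. fmem x trivial) p" by (intro fballI)
  show "fmem zero trivial p" using assms by (rule zero_in_trivial)
  show "fball trivial (\<lambda>x. fball trivial (\<lambda>y. fimp (fpair_in x y diagonal) (fmem y trivial))) p"
    by (intro fballI fimpI) (rule fmem_mono)
  show "fball trivial (\<lambda>x. fball trivial (\<lambda>y. fbex trivial (\<lambda>z.
      fand (fpair_in z x diagonal) (fpair_in z y diagonal)))) p"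
  proof (intro fballI fbexI [of zero] name_constants zero_in_trivial)
    fix x q y r s assume *: "fmem x trivial q" "leq r q" "fmem y trivial r" "leq s r"
    then show "s \<in> elts P" by (simp add: leq_dom)
    then show "fand (fpair_in zero x diagonal) (fpair_in zero y diagonal) s"
      using * unfolding fand_def by (meson fmem_mono leq_trans pair_in_diagonal zero_in_trivial)
  qed
qed

text \<open>Density at \<open>zero\<close> yields a member of \<open>d\<close>; as a condition it
  belongs to the forcing notion, which is also the filter.\<close>

lemma trivial_meets_dense:
  assumes d: "f_dense_open trivial diagonal d p"
  shows "fbex trivial (\<lambda>x. fmem x d) p"
  unfolding fbex_iff
proof (intro allI impI)
  fix q assume q: "leq q p"
  have sub: "fball d (\<lambda>x. fmem x trivial) p"
    and dense: "fball trivial (\<lambda>x. fbex d (\<lambda>y. fpair_in y x diagonal)) p"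
    using d unfolding f_dense_open_def fand_def fsubset_def by blast+
  obtain r where r: "leq r q" "fbex d (\<lambda>y. fpair_in y zero diagonal) r"
    using fballD [OF dense name_constants(1) q zero_in_trivial] leq_dom(1) [OF q] by blast
  obtain y s where y: "y \<in> names" "leq s r" "fmem y d s"
    using r(2) leq_refl [OF leq_dom(1) [OF r(1)]] unfolding fbex_iff by blast
  have s: "leq s q" using y(2) r(1) by (rule leq_trans)
  obtain s' where "leq s' s" "fmem y trivial s'"
    using fballD [OF sub y(1) leq_trans [OF s q] y(3)] .
  then show "\<exists>x\<in>names. \<exists>r. leq r q \<and> fmem x trivial r \<and> fmem x d r"
    using y s leq_trans fmem_mono by blast
qed

end

section \<open>Decomposing a symmetric system that \<open>j\<close> fixes\<close>

locale symmetric_model = symmetric_structure mem P le one G F + forcing_model mem P le one j M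
  for mem :: "'v \<Rightarrow> 'v \<Rightarrow> bool" and P le one G F :: 'v and j :: "'v \<Rightarrow> 'v" and M :: "'v set" +
  assumes symmetric: symmetric_system
begin

lemma G_group: "automorphism_group G" and G_in_F: "G \<in> elts F"
  using symmetric unfolding symmetric_system_def by blast+

lemma G_automorphism: "\<sigma> \<in> elts G \<Longrightarrow> automorphism \<sigma>"
  using G_group unfolding automorphism_group_def by blast

lemma sym_one_name:
  assumes "x \<in> one_names"
  shows "sym x = G"
proof -
  have "{\<sigma> \<in> elts G. act \<sigma> x = x} = elts G"
    using act_one_name [OF assms] G_automorphism unfolding automorphism_def by blast
  then show ?thesis unfolding sym_def by simp
qed

text \<open>The closed set that witnesses \<open>one_names\<close> consists of such names, each with
  symmetry group \<open>G\<close>, so it also witnesses hereditary symmetry.\<close>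

lemma one_names_HS: "x \<in> one_names \<Longrightarrow> x \<in> HS"
proof -
  assume "x \<in> one_names"
  then obtain t where t: "x \<in> elts t" "\<forall>y\<in>elts t. \<forall>z\<in>elts y. \<exists>w\<in>elts t. z = opair one w"
    unfolding one_names_def by blast
  then have "y \<in> one_names" if "y \<in> elts t" for y
    using that unfolding one_names_def by blast
  then have "\<forall>y\<in>elts t. sym y \<in> elts F"
    using sym_one_name G_in_F by simp
  then show "x \<in> HS" unfolding HS_def using t one_in_P by blast
qed

lemma trivial_symmetrically_generic:
  assumes "p \<in> elts P"
  shows "f_symmetrically_generic X trivial diagonal zero \<tau> trivial p"
  unfolding f_symmetrically_generic_def fand_def [of _ _ p] fall_def
  using f_filter_trivial [OF assms] trivial_meets_dense
  by (intro conjI ballI fimpI) (simp_all add: f_symmetrically_dense_open_def fand_def)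

text \<open>The part of \<open>j P\<close> below \<open>one\<close> is \<open>P\<close> itself, so
  \<open>\<pi>\<close> only adds the second coordinate \<open>0\<close>, and \<open>\<tau>\<close>
  adds the identity automorphism \<open>diagonal\<close>. Elements must be fixed as well as sets,
  since decomposability applies \<open>j\<close> to single conditions, automorphisms and
  groups.\<close>

lemma j_decomposable_if_fixed:
  assumes P: "j P = P" and le: "j le = le" and F: "j F = F"
    and p_fixed: "\<And>p. p \<in> elts P \<Longrightarrow> j p = p"
    and G_fixed: "\<And>\<sigma>. \<sigma> \<in> elts G \<Longrightarrow> j \<sigma> = \<sigma>"
    and F_fixed: "\<And>K. K \<in> elts F \<Longrightarrow> j K = K"
  shows "j_decomposable j M"
proof -
  define \<pi> where "\<pi> = vset {opair p (opair p zero) |p. p \<in> elts P}"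
  define \<tau> where "\<tau> = vset {opair \<sigma> (opair \<sigma> diagonal) |\<sigma>. \<sigma> \<in> elts G}"
  have "fterm (\<lambda>s. opair (s 0) zero)" by (rule definable_intros)+
  note graph = is_fun_graph [of "\<lambda>p. opair p zero", OF this]
  have \<pi>: "is_fun \<pi> P" "\<And>p. p \<in> elts P \<Longrightarrow> app \<pi> p = opair p zero"
    unfolding \<pi>_def by (rule graph, assumption?)+
  have "fterm (\<lambda>s. opair (s 0) diagonal)" by (rule definable_intros)+
  note graph = is_fun_graph [of "\<lambda>\<sigma>. opair \<sigma> diagonal", OF this]
  have \<tau>: "is_fun \<tau> G" "\<And>\<sigma>. \<sigma> \<in> elts G \<Longrightarrow> app \<tau> \<sigma> = opair \<sigma> diagonal"
    unfolding \<tau>_def by (rule graph, assumption?)+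
  have "{r \<in> elts P. opair r one \<in> elts le} = elts P"
    using leq_one unfolding leq_def by blast
  then have below: "below j one = P"
    unfolding below_def P le by simp
  have zero: "zero \<in> names" by (rule name_constants)
  have refl_zero: "feq zero zero p" if "p \<in> elts P" for p
    using feq_refl subsetD [OF names_subset_namelike zero] that by blast
  have iter: "opair p zero \<in> iter trivial" if "p \<in> elts P" for p
    using that zero zero_in_trivial unfolding iter_def forced_def by blast
  have iso: "decomposing_isomorphism j one trivial diagonal zero \<pi>"
    unfolding decomposing_isomorphism_def below le
  proof (intro conjI ballI)
    fix c assume "c \<in> iter trivial"
    then obtain p q where c: "c = opair p q" "p \<in> elts P" "forced (fmem q trivial)"
      unfolding iter_def by blast
    \<comment> \<open>Surjectivity holds up to \<open>iter_eq\<close>: a name forced into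
      \<open>{0}\<close> is densely, hence outright, equal to \<open>0\<close>.\<close>
    have "feq zero q p"
      using trivial_eq_dense zero_in_trivial c(2,3) unfolding forced_def by (intro feq_dense) blast+
    then have "iter_eq (app \<pi> p) c" unfolding iter_eq_def using c \<pi>(2) by simp
    then show "\<exists>r\<in>elts P. iter_eq (app \<pi> r) c" using c(2) by blast
  next
    fix r s assume r: "r \<in> elts P" and s: "s \<in> elts P"
    show "iter_eq (app \<pi> r) (app \<pi> s) \<longrightarrow> r = s"
      unfolding iter_eq_def using \<pi>(2) r s by simp
    show "opair r s \<in> elts le \<longleftrightarrow> iter_leq diagonal (app \<pi> r) (app \<pi> s)"
      unfolding iter_leq_def using \<pi>(2) r s pair_in_diagonal zero_in_trivial by (simp add: leq_def)
  next
    fix p assume p: "p \<in> elts P"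
    show "iter_eq (app \<pi> (j p)) (opair p zero)"
      unfolding iter_eq_def using \<pi>(2) [OF p] p_fixed [OF p] refl_zero [OF p] by simp
    show "j p \<in> elts P" using p p_fixed by simp
  qed (use \<pi> iter in simp_all)
  have embedding: "sdp_embedding trivial trivial_group \<tau>"
    unfolding sdp_embedding_def
  proof (intro conjI ballI)
    show "is_fun \<tau> G" by (rule \<tau>)
    show "app \<tau> \<sigma> \<in> sdp trivial_group" if "\<sigma> \<in> elts G" for \<sigma>
      using that \<tau>(2) name_constants diagonal_in_group unfolding sdp_def forced_def by auto
  next
    fix \<sigma> \<sigma>' assume \<sigma>: "\<sigma> \<in> elts G" "\<sigma>' \<in> elts G"
    then have "comp_fun \<sigma> \<sigma>' \<in> elts G"
      using G_group unfolding automorphism_group_def by blast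
    then show "sdp_mult trivial (app \<tau> \<sigma>) (app \<tau> \<sigma>') (app \<tau> (comp_fun \<sigma> \<sigma>'))"
      unfolding sdp_mult_def forced_def using \<sigma> \<tau>(2) f_comp_diagonal by simp
    show "sdp_eq (app \<tau> \<sigma>) (app \<tau> \<sigma>') \<longrightarrow> \<sigma> = \<sigma>'"
      unfolding sdp_eq_def using \<sigma> \<tau>(2) by simp
  qed
  have transport: "transports j one \<pi> \<tau>"
    unfolding transports_def below
  proof (intro ballI conjI)
    fix \<sigma> assume \<sigma>: "\<sigma> \<in> elts G"
    then show "ofst (app \<tau> \<sigma>) = \<sigma>" using \<tau>(2) by simp
    fix r assume r: "r \<in> elts P"
    have \<sigma>r: "app \<sigma> r \<in> elts P" and \<sigma>_one: "app \<sigma> one = one"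
      using G_automorphism [OF \<sigma>] r unfolding automorphism_def bij_fun_def bij_betw_def by blast+
    then show "app (j \<sigma>) r \<in> elts P" using G_fixed [OF \<sigma>] by simp
    \<comment> \<open>The image of \<open>0\<close> under the second coordinate can again be named
      by \<open>zero\<close>, which \<open>\<sigma>\<close> leaves unchanged.\<close>
    have "forced (fpair_in zero zero diagonal)"
      unfolding forced_def using pair_in_diagonal zero_in_trivial by blast
    moreover have "act \<sigma> zero = zero" using act_one_name [OF zero_one_name \<sigma>_one] .
    ultimately show "sdp_act (app \<tau> \<sigma>) (app \<pi> r) (app \<pi> (app (j \<sigma>) r))"
      unfolding sdp_act_def iter_eq_def
      using \<tau>(2) [OF \<sigma>] \<pi>(2) [OF r] \<pi>(2) [OF \<sigma>r] G_fixed [OF \<sigma>] refl_zero [OF \<sigma>r] zero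
      by (intro bexI [of _ zero]) simp_all
  qed
  show ?thesis
    unfolding j_decomposable_def
  proof (intro exI conjI)
    show "one \<in> elts (j P)" using P one_in_P by simp
    show "trivial \<in> HS" "diagonal \<in> HS" "zero \<in> HS" "trivial \<in> HS" "trivial_group \<in> HS"
      by (intro one_names_HS one_name_constants zero_one_name)+
    show "sym trivial = G" "sym diagonal = G" "sym zero = G" "sym trivial_group = G"
      by (intro sym_one_name one_name_constants zero_one_name)+
    show "forced (f_forcing_notion trivial diagonal zero)"
      "forced (f_symmetrically_generic M trivial diagonal zero \<tau> trivial)"
      "forced (f_automorphism_group trivial diagonal zero trivial_group)"
      unfolding forced_def
      using trivial_forcing_notion trivial_symmetrically_generic trivial_group_is_group by blast+
    show "decomposing_isomorphism j one trivial diagonal zero \<pi>" by (rule iso)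
    show "sdp_embedding trivial trivial_group \<tau>" by (rule embedding)
    show "transports j one \<pi> \<tau>" by (rule transport)
    show "\<forall>\<sigma>\<in>elts G. forced (f_image_fixed trivial (osnd (app \<tau> \<sigma>)) trivial)"
      unfolding forced_def using f_image_fixed_trivial by blast
    show "\<forall>K\<in>elts F. j K \<in> elts (j F)" using F F_fixed by simp
    show "\<forall>L\<in>elts (j F). \<exists>K\<in>elts F. elts (j K) \<subseteq> elts L" using F F_fixed by auto
  qed
qed

end

section \<open>The components of a system in the level at \<open>\<kappa>\<close>\<close>

theorem theorem4p9:
  fixes mem :: "'v \<Rightarrow> 'v \<Rightarrow> bool"
    and j :: "'v \<Rightarrow> 'v" and M :: "'v set"
    and \<kappa> P le one G F :: 'v
  assumes "set_structure.models_ZF mem j M"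
    and "set_structure.critical_cardinal mem \<kappa>"
    and "symmetric_structure.symmetric_system mem P le one G F"
    and "mem (symmetric_structure.system mem P le one G F) (set_structure.cumul mem \<kappa>)"
    and "set_structure.elementary_embedding mem j M"
    and "set_structure.critical_point mem j \<kappa>"
  shows "symmetric_structure.j_decomposable mem P le one G F j M"
proof -
  interpret symmetric_structure mem P le one G F .
  interpret symmetric_model mem P le one G F j M
  proof
    show "models_ZF j M" by (rule assms(1))
    show "symmetric_system" by (rule assms(3))
    then show "forcing_notion" unfolding symmetric_system_def by (rule conjunct1)
  qed
  have \<kappa>: "ordinal \<kappa>" using assms(6) unfolding critical_point_def by blast
  have "system \<in> elts (cumul \<kappa>)" using assms(4) unfolding elts_def by simp
  note split = opair_in_cumul [OF \<kappa> this [unfolded system_def]]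
  \<comment> \<open>In this order: \<open>P\<close>, \<open>le\<close>, \<open>G\<close>,
    \<open>F\<close>. Transitivity of the level is used below for the first, third and fourth, whose
    elements must be fixed too.\<close>
  note in_cumul = opair_in_cumul(1) [OF \<kappa> split(1)]
    opair_in_cumul(1) [OF \<kappa> opair_in_cumul(2) [OF \<kappa> split(1)]]
    opair_in_cumul [OF \<kappa> split(2)]
  note fixed = fixed_if_in_cumul [OF assms(5,6)]
  show ?thesis
    by (intro j_decomposable_if_fixed fixed in_cumul) (erule cumul_transitive [OF \<kappa> in_cumul(1)]
        cumul_transitive [OF \<kappa> in_cumul(3)] cumul_transitive [OF \<kappa> in_cumul(4)])+
qed

end
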